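(* Thompson's group $T$ is not invariably generated.
   Context: $S^1$ is the interval $[0,1]$ with $0$ and $1$ identified. Thompson's group $T$ is the group of piecewise linear orientation-preserving homeomorphisms of $S^1$ which preserve the set of finite dyadic fractions, have finitely many breakpoints, all at finite dyadic fractions, and all slopes integer powers of $2$. A group $G$ is invariably generated if there is a subset $S\subseteq G$ such that $G=\langle s^{g(s)}: s\in S\rangle$ for every choice of $g(s)\in G$, $s\in S$; equivalently, no proper subgroup of $G$ meets every conjugacy class of $G$. *)

theory Defs
  imports Complex_Main "HOL-Algebra.Generated_Groups"
begin

definition dyadic :: "real \<Rightarrow> bool" where
  "dyadic x \<longleftrightarrow> (\<exists>m::int. \<exists>n::nat. x = real_of_int m / 2 ^ n)"

text \<open>S^1 = [0,1] with 0 ~ 1, represented by [0,1) via frac.  An element of T is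
  given through its lift F : R -> R (a continuous, strictly increasing map with
  F(x+1) = F(x) + 1, i.e. an orientation-preserving circle homeomorphism), which is
  piecewise linear with finitely many breakpoints in [0,1], all dyadic, all slopes
  integer powers of 2, and which preserves the dyadic rationals.\<close>
definition thompson_lift :: "(real \<Rightarrow> real) \<Rightarrow> bool" where
  "thompson_lift F \<longleftrightarrow>
     continuous_on UNIV F \<and> strict_mono F \<and> (\<forall>x. F (x + 1) = F x + 1) \<and>
     (\<forall>x. dyadic x \<longleftrightarrow> dyadic (F x)) \<and>
     (\<exists>B. finite B \<and> (\<forall>b\<in>B. dyadic b) \<and>
        (\<forall>x\<in>{0..1} - B. \<exists>k::int. \<exists>e>0. \<forall>y. \<bar>y - x\<bar> < e \<longrightarrow>
              F y = F x + 2 powr (real_of_int k) * (y - x)))"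

definition thompson_T_set :: "(real \<Rightarrow> real) set" where
  "thompson_T_set = {(\<lambda>x. frac (F x)) | F. thompson_lift F}"

definition thompson_T :: "(real \<Rightarrow> real) monoid" where
  "thompson_T = \<lparr>carrier = thompson_T_set, mult = (\<circ>), one = frac\<rparr>"

definition invariably_generated :: "('a, 'b) monoid_scheme \<Rightarrow> bool" where
  "invariably_generated G \<longleftrightarrow>
     (\<exists>S \<subseteq> carrier G. \<forall>g \<in> S \<rightarrow> carrier G.
        generate G ((\<lambda>s. inv\<^bsub>G\<^esub> (g s) \<otimes>\<^bsub>G\<^esub> s \<otimes>\<^bsub>G\<^esub> g s) ` S) = carrier G)"

end

theory Submission
  imports Defs "HOL-Algebra.Group_Action" "HOL-Analysis.Lipschitz" "HOL-Library.Periodic_Fun"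
begin

text \<open>
  Ping-pong. Suppose that every \<open>s \<in> T\<close> has an interval \<open>I\<close> of the circle that is wandering,
  i.e. \<open>s\<^sup>k I \<inter> I = {}\<close> whenever \<open>s\<^sup>k \<noteq> 1\<close>. Since \<open>T\<close> is countable, one can choose
  pairwise disjoint intervals \<open>J\<^sub>s \<subseteq> [0, 1/2)\<close>, and an element \<open>g\<^sub>s \<in> T\<close> that maps the
  complement of \<open>J\<^sub>s\<close> into \<open>I\<close>. The nontrivial powers of the conjugate of \<open>s\<close> by \<open>g\<^sub>s\<close>
  then map the complement of \<open>J\<^sub>s\<close> into \<open>J\<^sub>s\<close>, so the orbit of \<open>1/2\<close> under the group
  generated by these conjugates lies in \<open>{1/2} \<union> (\<Union>s. J\<^sub>s)\<close>. It misses \<open>3/4\<close>, although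
  the rotation by \<open>1/4\<close> belongs to \<open>T\<close>.

  Wandering intervals come from asymptotic points, i.e. points \<open>u < v\<close> with
  \<open>F\<^sup>n v - F\<^sup>n u \<rightarrow> 0\<close> for a lift \<open>F\<close> of \<open>s\<close>. The classes of this relation are bounded
  intervals which the maps \<open>F\<^sup>k - m\<close> permute, so if \<open>F\<^sup>k - m\<close> moves some point of \<open>(u, v)\<close> into
  \<open>(u, v)\<close>, then it fixes the right end point \<open>a\<close> of the class of \<open>u\<close>. If \<open>s\<close> has no
  periodic points, this is impossible for \<open>k > 0\<close>. Otherwise let \<open>q\<close> be the least period
  and \<open>F\<^sup>q b = b + p\<close>. Every \<open>c\<close> is asymptotic to \<open>F\<^sup>q c - p\<close>; hence \<open>F\<^sup>q - p\<close> fixes \<open>a\<close> as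
  well, \<open>q\<close> divides \<open>k\<close>, and the interval between \<open>c\<close> and \<open>F\<^sup>q c - p\<close> is wandering unless it
  is empty. If it is empty for every \<open>c\<close>, then \<open>s\<^sup>q = 1\<close> and every short interval is wandering.

  It remains to find asymptotic points when \<open>s\<close> has no periodic points. The orbit of \<open>0\<close> consists
  of dyadic points which are distinct modulo \<open>1\<close>, so their denominators tend to infinity. Where the
  denominator \<open>2\<^sup>d\<close> of a dyadic point \<open>x\<close> is large, the slope of \<open>F\<close> at \<open>x\<close> is exactly the
  factor by which the denominator decreases, so that \<open>F (x + 1/2\<^sup>d) = F x + 1/2\<^sup>e\<close>, where
  \<open>2\<^sup>e\<close> is the denominator of \<open>F x\<close>. Thus far along the orbit of \<open>0\<close>, the point \<open>x\<close> is
  asymptotic to \<open>x + 1/2\<^sup>d\<close>.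
\<close>

section \<open>Lifts of circle homeomorphisms\<close>

lemma frac_eq_frac_iff: "frac x = frac y \<longleftrightarrow> x - y \<in> \<int>"
  for x y :: "'a::floor_ceiling"
proof
  assume "frac x = frac y"
  then have "x - y = of_int (\<lfloor>x\<rfloor> - \<lfloor>y\<rfloor>)" by (simp add: frac_def algebra_simps)
  then show "x - y \<in> \<int>" by (simp only: Ints_of_int)
next
  assume "x - y \<in> \<int>"
  then show "frac x = frac y" using frac_add_int_right[of "x - y" y] by simp
qed

definition degree_one :: "(real \<Rightarrow> real) \<Rightarrow> bool" where
  "degree_one F \<longleftrightarrow> continuous_on UNIV F \<and> strict_mono F \<and> (\<forall>x. F (x + 1) = F x + 1)"

lemma degree_one_add_Ints:
  assumes "degree_one F" "m \<in> \<int>"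
  shows "F (x + m) = F x + m"
proof -
  interpret displacement: periodic_fun_simple' "\<lambda>x. F x - x"
    by unfold_locales (use assms(1) in \<open>simp add: degree_one_def\<close>)
  from assms(2) show ?thesis
  proof (cases rule: Ints_cases)
    case (of_int n)
    then show ?thesis using displacement.plus_of_int[of x n] by simp
  qed
qed

lemma degree_one_diff_Ints:
  assumes "degree_one F" "m \<in> \<int>"
  shows "F (x - m) = F x - m"
  using degree_one_add_Ints[of F "- m" x] assms by simp

lemma degree_one_less_iff: "degree_one F \<Longrightarrow> F x < F y \<longleftrightarrow> x < y"
  and degree_one_le_iff: "degree_one F \<Longrightarrow> F x \<le> F y \<longleftrightarrow> x \<le> y"
  and degree_one_eq_iff: "degree_one F \<Longrightarrow> F x = F y \<longleftrightarrow> x = y"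
  by (auto simp: degree_one_def strict_mono_less strict_mono_less_eq strict_mono_eq)

lemma degree_one_isCont: "degree_one F \<Longrightarrow> isCont F x"
  by (simp add: degree_one_def continuous_on_eq_continuous_at)

lemma degree_one_id: "degree_one id"
  by (simp add: degree_one_def strict_mono_def)

lemma degree_one_comp:
  assumes "degree_one F" "degree_one G"
  shows "degree_one (F \<circ> G)"
  unfolding degree_one_def
proof (intro conjI)
  show "continuous_on UNIV (F \<circ> G)"
    using assms unfolding degree_one_def
    by (intro continuous_on_compose) (auto intro: continuous_on_subset)
  show "strict_mono (F \<circ> G)"
    using assms by (simp add: strict_mono_def degree_one_less_iff)
qed (use assms in \<open>simp add: degree_one_def\<close>)

lemma degree_one_funpow: "degree_one F \<Longrightarrow> degree_one (F ^^ n)"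
  by (induction n) (auto intro: degree_one_id degree_one_comp simp flip: id_def)

lemma degree_one_bij:
  assumes F: "degree_one F"
  shows "bij F"
proof (rule bijI)
  show "inj F" by (rule injI) (simp add: degree_one_eq_iff[OF F])
  show "surj F"
    unfolding surj_def
  proof
    fix y
    define m where "m = real_of_int \<lfloor>y - F 0\<rfloor>"
    have "m \<in> \<int>" by (simp add: m_def)
    have "F m \<le> y"
      using degree_one_add_Ints[OF F \<open>m \<in> \<int>\<close>, of 0] by (simp add: m_def) linarith
    moreover have "y \<le> F (m + 1)"
      using degree_one_add_Ints[OF F Ints_add[OF \<open>m \<in> \<int>\<close> Ints_1], of 0]
      by (simp add: m_def) linarith
    ultimately show "\<exists>x. y = F x"
      using IVT[of F m y "m + 1"] degree_one_isCont[OF F] by auto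
  qed
qed

lemma degree_one_f_inv: "degree_one F \<Longrightarrow> F (inv_into UNIV F y) = y"
  and degree_one_inv_f: "degree_one F \<Longrightarrow> inv_into UNIV F (F x) = x"
  by (simp_all add: degree_one_bij bij_is_surj bij_is_inj surj_f_inv_f)

lemma degree_one_inv:
  assumes F: "degree_one F"
  shows "degree_one (inv_into UNIV F)"
proof -
  note F_inv = degree_one_f_inv[OF F]
  have less: "inv_into UNIV F x < inv_into UNIV F y \<longleftrightarrow> x < y" for x y
    using degree_one_less_iff[OF F, of "inv_into UNIV F x" "inv_into UNIV F y"]
    by (simp add: F_inv)
  then have "strict_mono (inv_into UNIV F)" by (simp add: strict_mono_def)
  moreover have "continuous_on UNIV (inv_into UNIV F)"
  proof (rule continuous_onI_mono)
    show "open (range (inv_into UNIV F))"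
      by (simp add: bij_is_surj[OF bij_imp_bij_inv[OF degree_one_bij[OF F]]])
    show "inv_into UNIV F x \<le> inv_into UNIV F y" if "x \<le> y" for x y
      using that less[of y x] by linarith
  qed
  moreover have "inv_into UNIV F (x + 1) = inv_into UNIV F x + 1" for x
    using degree_one_eq_iff[OF F, of "inv_into UNIV F (x + 1)" "inv_into UNIV F x + 1"] F
    by (simp add: F_inv degree_one_def)
  ultimately show ?thesis by (simp add: degree_one_def)
qed

lemma frac_degree_one_frac: "degree_one F \<Longrightarrow> frac (F (frac x)) = frac (F x)"
  by (simp add: frac_def[of x] degree_one_diff_Ints frac_eq_frac_iff)

lemma finite_frac_image_degree_one:
  assumes "degree_one F" "finite (frac ` A)"
  shows "finite (frac ` F ` A)"
proof -
  have "frac ` F ` A = (\<lambda>x. frac (F x)) ` frac ` A"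
    by (simp add: image_image frac_degree_one_frac[OF assms(1)])
  with assms(2) show ?thesis by simp
qed

section \<open>Dyadic rationals\<close>

lemma dyadic_iff_Ints: "dyadic x \<longleftrightarrow> (\<exists>n. x * 2 ^ n \<in> \<int>)"
proof -
  have "x * 2 ^ n \<in> \<int> \<longleftrightarrow> (\<exists>m. x = real_of_int m / 2 ^ n)" for n
    by (auto simp: Ints_def field_simps)
  then show ?thesis unfolding dyadic_def by blast
qed

lemma Ints_mult_power2_mono:
  fixes x :: "'a::ring_1"
  assumes "x * 2 ^ n \<in> \<int>" "n \<le> k"
  shows "x * 2 ^ k \<in> \<int>"
proof -
  have "x * 2 ^ k = x * 2 ^ n * 2 ^ (k - n)"
    using assms(2) by (simp add: mult.assoc flip: power_add)
  with assms(1) show ?thesis by simp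
qed

lemma dyadic_add:
  assumes "dyadic x" "dyadic y"
  shows "dyadic (x + y)"
proof -
  obtain a b where "x * 2 ^ a \<in> \<int>" "y * 2 ^ b \<in> \<int>"
    using assms unfolding dyadic_iff_Ints by blast
  then have "x * 2 ^ max a b \<in> \<int>" "y * 2 ^ max a b \<in> \<int>"
    by (auto elim: Ints_mult_power2_mono)
  then have "(x + y) * 2 ^ max a b \<in> \<int>" by (simp add: distrib_right)
  then show ?thesis unfolding dyadic_iff_Ints by blast
qed

lemma dyadic_minus: "dyadic x \<Longrightarrow> dyadic (- x)"
  by (auto simp: dyadic_iff_Ints)

lemma dyadic_Ints: "x \<in> \<int> \<Longrightarrow> dyadic x"
  unfolding dyadic_iff_Ints by (rule exI[of _ 0]) simp

lemma dyadic_divide_power2_iff: "dyadic (x / 2 ^ k) \<longleftrightarrow> dyadic x"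
proof
  assume "dyadic x"
  then obtain n where "x * 2 ^ n \<in> \<int>" by (auto simp: dyadic_iff_Ints)
  then have "x / 2 ^ k * 2 ^ (n + k) \<in> \<int>" by (simp add: power_add)
  then show "dyadic (x / 2 ^ k)" unfolding dyadic_iff_Ints by blast
next
  assume "dyadic (x / 2 ^ k)"
  then obtain n where "x / 2 ^ k * 2 ^ n \<in> \<int>" by (auto simp: dyadic_iff_Ints)
  then have "x / 2 ^ k * 2 ^ (n + k) \<in> \<int>" by (rule Ints_mult_power2_mono) simp
  then have "x * 2 ^ n \<in> \<int>" by (simp add: power_add)
  then show "dyadic x" unfolding dyadic_iff_Ints by blast
qed

lemma dyadic_add_iff: "dyadic y \<Longrightarrow> dyadic (x + y) \<longleftrightarrow> dyadic x"
  using dyadic_add[of "x + y" "- y"] dyadic_add[of x y] dyadic_minus[of y] by auto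

lemma dyadic_frac_iff: "dyadic (frac x) \<longleftrightarrow> dyadic x"
  using dyadic_add_iff[OF dyadic_Ints, of "- of_int \<lfloor>x\<rfloor>" x] by (simp add: frac_def)

lemma countable_dyadic: "countable {x. dyadic x}"
proof -
  have "{x. dyadic x} = (\<lambda>(m, n). real_of_int m / 2 ^ n) ` UNIV"
    by (auto simp: dyadic_def)
  then show ?thesis by simp
qed

definition dyadic_exponent :: "real \<Rightarrow> nat" where
  "dyadic_exponent x = (LEAST n. x * 2 ^ n \<in> \<int>)"

lemma dyadic_exponent_le_iff:
  assumes "dyadic x"
  shows "dyadic_exponent x \<le> n \<longleftrightarrow> x * 2 ^ n \<in> \<int>"
proof
  have "x * 2 ^ dyadic_exponent x \<in> \<int>"
    using assms unfolding dyadic_exponent_def dyadic_iff_Ints by (rule LeastI_ex)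
  then show "x * 2 ^ n \<in> \<int>" if "dyadic_exponent x \<le> n"
    using that by (rule Ints_mult_power2_mono)
qed (simp add: dyadic_exponent_def Least_le)

lemma dyadic_exponent_add_Ints:
  assumes "m \<in> \<int>"
  shows "dyadic_exponent (x + m) = dyadic_exponent x"
proof -
  have "(x + m) * 2 ^ n \<in> \<int> \<longleftrightarrow> x * 2 ^ n \<in> \<int>" for n
  proof -
    have "m * 2 ^ n \<in> \<int>" using assms by simp
    then show ?thesis by (simp add: distrib_right)
  qed
  then show ?thesis by (simp add: dyadic_exponent_def)
qed

lemma dyadic_exponent_frac: "dyadic_exponent (frac x) = dyadic_exponent x"
  using dyadic_exponent_add_Ints[of "- of_int \<lfloor>x\<rfloor>" x] by (simp add: frac_def)

definition dyadic_succ :: "real \<Rightarrow> real" where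
  "dyadic_succ x = x + 1 / 2 ^ dyadic_exponent x"

section \<open>Lifts of elements of Thompson's group\<close>

definition pow2_affine_at :: "(real \<Rightarrow> real) \<Rightarrow> real \<Rightarrow> bool" where
  "pow2_affine_at F x \<longleftrightarrow>
     (\<exists>k::int. \<forall>\<^sub>F y in nhds x. F y = F x + 2 powr of_int k * (y - x))"

definition breakpoints :: "(real \<Rightarrow> real) \<Rightarrow> real set" where
  "breakpoints F = {x. \<not> pow2_affine_at F x}"

lemma pow2_affine_at_translation: "pow2_affine_at (\<lambda>x. x + r) x"
  unfolding pow2_affine_at_def by (rule exI[of _ 0]) simp

lemma pow2_affine_at_comp:
  assumes "isCont G x" "pow2_affine_at F (G x)" "pow2_affine_at G x"
  shows "pow2_affine_at (F \<circ> G) x"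
proof -
  obtain k l :: int where
    F: "\<forall>\<^sub>F z in nhds (G x). F z = F (G x) + 2 powr of_int k * (z - G x)" and
    G: "\<forall>\<^sub>F y in nhds x. G y = G x + 2 powr of_int l * (y - x)"
    using assms(2,3) unfolding pow2_affine_at_def by blast
  have "filterlim G (nhds (G x)) (nhds x)"
    using assms(1) by (simp add: isCont_def tendsto_at_iff_tendsto_nhds)
  from eventually_compose_filterlim[OF F this] G
  have "\<forall>\<^sub>F y in nhds x. (F \<circ> G) y = (F \<circ> G) x + 2 powr of_int (k + l) * (y - x)"
    by eventually_elim (simp add: powr_add)
  then show ?thesis unfolding pow2_affine_at_def by blast
qed

lemma pow2_affine_at_inv:
  assumes F: "degree_one F" and "pow2_affine_at F (inv_into UNIV F y)"
  shows "pow2_affine_at (inv_into UNIV F) y"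
proof -
  note F_inv = degree_one_f_inv[OF F]
  obtain k :: int where k: "\<forall>\<^sub>F x in nhds (inv_into UNIV F y).
      F x = y + 2 powr of_int k * (x - inv_into UNIV F y)"
    using assms(2) unfolding pow2_affine_at_def F_inv by blast
  have "filterlim (inv_into UNIV F) (nhds (inv_into UNIV F y)) (nhds y)"
    using degree_one_isCont[OF degree_one_inv[OF F]]
    by (simp add: isCont_def tendsto_at_iff_tendsto_nhds)
  from eventually_compose_filterlim[OF k this]
  have "\<forall>\<^sub>F z in nhds y.
      inv_into UNIV F z = inv_into UNIV F y + 2 powr of_int (- k) * (z - y)"
    by eventually_elim (simp add: F_inv powr_minus field_simps)
  then show ?thesis unfolding pow2_affine_at_def by blast
qed

lemma frac_in_breakpoints_iff:
  assumes F: "degree_one F"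
  shows "frac x \<in> breakpoints F \<longleftrightarrow> x \<in> breakpoints F"
proof -
  have shift: "pow2_affine_at F (z + m)" if "pow2_affine_at F z" "m \<in> \<int>" for z m
  proof -
    have "F = (\<lambda>y. y + m) \<circ> (F \<circ> (\<lambda>y. y + - m))"
      using degree_one_diff_Ints[OF F that(2)] by auto
    moreover have "pow2_affine_at ((\<lambda>y. y + m) \<circ> (F \<circ> (\<lambda>y. y + - m))) (z + m)"
      using that(1) degree_one_isCont[OF F]
      by (intro pow2_affine_at_comp pow2_affine_at_translation continuous_intros) simp_all
    ultimately show ?thesis by simp
  qed
  have "x = frac x + of_int \<lfloor>x\<rfloor>" by (simp add: frac_def)
  then show ?thesis
    using shift[of "frac x" "of_int \<lfloor>x\<rfloor>"] shift[of x "- of_int \<lfloor>x\<rfloor>"]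
    by (auto simp: breakpoints_def frac_def)
qed

lemma finite_dyadic_breakpoints_iff:
  assumes F: "degree_one F"
  shows "(\<exists>B. finite B \<and> (\<forall>b\<in>B. dyadic b) \<and> (\<forall>x\<in>{0..1} - B. pow2_affine_at F x)) \<longleftrightarrow>
     finite (frac ` breakpoints F) \<and> breakpoints F \<subseteq> {x. dyadic x}" (is "?L \<longleftrightarrow> ?R")
proof
  assume ?L
  then obtain B where B: "finite B" "\<forall>b\<in>B. dyadic b" "\<forall>x\<in>{0..1} - B. pow2_affine_at F x"
    by blast
  have "frac ` breakpoints F \<subseteq> B"
  proof (rule image_subsetI)
    fix x assume "x \<in> breakpoints F"
    then have "frac x \<in> breakpoints F" by (simp add: frac_in_breakpoints_iff[OF F])
    moreover have "frac x \<in> {0..1}" by (simp add: less_imp_le[OF frac_lt_1])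
    ultimately show "frac x \<in> B" using B(3) unfolding breakpoints_def by blast
  qed
  moreover from this B(2) have "dyadic x" if "x \<in> breakpoints F" for x
    using that dyadic_frac_iff[of x] by blast
  ultimately show ?R using finite_subset[OF _ B(1)] by blast
next
  assume R: ?R
  have "pow2_affine_at F x" if x: "x \<in> {0..1} - insert 1 (frac ` breakpoints F)" for x
  proof -
    have "frac x = x" using x by (auto simp: frac_eq)
    with x show ?thesis unfolding breakpoints_def by force
  qed
  with R show ?L
    by (intro exI[of _ "insert 1 (frac ` breakpoints F)"]) (auto simp: dyadic_frac_iff dyadic_Ints)
qed

lemma thompson_lift_iff:
  "thompson_lift F \<longleftrightarrow> degree_one F \<and> (\<forall>x. dyadic x \<longleftrightarrow> dyadic (F x)) \<and>
     finite (frac ` breakpoints F) \<and> breakpoints F \<subseteq> {x. dyadic x}"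
proof -
  have "thompson_lift F \<longleftrightarrow> degree_one F \<and> (\<forall>x. dyadic x \<longleftrightarrow> dyadic (F x)) \<and>
     (\<exists>B. finite B \<and> (\<forall>b\<in>B. dyadic b) \<and> (\<forall>x\<in>{0..1} - B. pow2_affine_at F x))"
    unfolding thompson_lift_def degree_one_def
      pow2_affine_at_def eventually_nhds_metric dist_real_def
    by (simp only: conj_assoc)
  then show ?thesis by (simp only: finite_dyadic_breakpoints_iff cong: conj_cong)
qed

lemma thompson_lift_degree_one: "thompson_lift F \<Longrightarrow> degree_one F"
  and thompson_lift_dyadic_iff: "thompson_lift F \<Longrightarrow> dyadic (F x) \<longleftrightarrow> dyadic x"
  by (auto simp: thompson_lift_iff)

lemma thompson_lift_translation:
  assumes "dyadic r"
  shows "thompson_lift (\<lambda>x. x + r)"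
proof -
  have "degree_one (\<lambda>x. x + r)"
    by (auto simp: degree_one_def strict_mono_def intro!: continuous_intros)
  moreover have "breakpoints (\<lambda>x. x + r) = {}"
    by (simp add: breakpoints_def pow2_affine_at_translation)
  ultimately show ?thesis by (simp add: thompson_lift_iff dyadic_add_iff[OF assms])
qed

lemma thompson_lift_id: "thompson_lift id"
  using thompson_lift_translation[OF dyadic_Ints[OF Ints_0]] by (simp add: id_def)

lemma thompson_lift_inv:
  assumes F: "thompson_lift F"
  shows "thompson_lift (inv_into UNIV F)"
proof -
  note deg_F = thompson_lift_degree_one[OF F]
  note F_inv = degree_one_f_inv[OF deg_F]
  have breaks: "breakpoints (inv_into UNIV F) \<subseteq> F ` breakpoints F"
  proof
    fix y assume "y \<in> breakpoints (inv_into UNIV F)"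
    then have "inv_into UNIV F y \<in> breakpoints F"
      using pow2_affine_at_inv[OF deg_F] by (auto simp: breakpoints_def)
    then show "y \<in> F ` breakpoints F" using F_inv[of y] by force
  qed
  have "finite (frac ` F ` breakpoints F)"
    using F finite_frac_image_degree_one[OF deg_F] by (simp add: thompson_lift_iff)
  then have "finite (frac ` breakpoints (inv_into UNIV F))"
    by (rule finite_subset[OF image_mono[OF breaks]])
  moreover have "breakpoints (inv_into UNIV F) \<subseteq> {x. dyadic x}"
    using breaks F by (auto simp: thompson_lift_iff)
  moreover have "dyadic (inv_into UNIV F x) \<longleftrightarrow> dyadic x" for x
    using thompson_lift_dyadic_iff[OF F, of "inv_into UNIV F x"] by (simp add: F_inv)
  ultimately show ?thesis by (simp add: thompson_lift_iff degree_one_inv[OF deg_F])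
qed

lemma thompson_lift_comp:
  assumes F: "thompson_lift F" and G: "thompson_lift G"
  shows "thompson_lift (F \<circ> G)"
proof -
  note deg_G = thompson_lift_degree_one[OF G]
  have breaks: "breakpoints (F \<circ> G) \<subseteq> breakpoints G \<union> inv_into UNIV G ` breakpoints F"
  proof
    fix x assume "x \<in> breakpoints (F \<circ> G)"
    then have "x \<in> breakpoints G \<or> G x \<in> breakpoints F"
      using pow2_affine_at_comp[OF degree_one_isCont[OF deg_G]] by (auto simp: breakpoints_def)
    moreover have "x = inv_into UNIV G (G x)"
      by (simp add: degree_one_inv_f[OF deg_G])
    ultimately show "x \<in> breakpoints G \<union> inv_into UNIV G ` breakpoints F" by blast
  qed
  have "finite (frac ` (breakpoints G \<union> inv_into UNIV G ` breakpoints F))"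
    using F G finite_frac_image_degree_one[OF degree_one_inv[OF deg_G]]
    by (simp add: thompson_lift_iff image_Un)
  then have "finite (frac ` breakpoints (F \<circ> G))"
    by (rule finite_subset[OF image_mono[OF breaks]])
  moreover have "breakpoints G \<union> inv_into UNIV G ` breakpoints F \<subseteq> {x. dyadic x}"
    using F G thompson_lift_dyadic_iff[OF thompson_lift_inv[OF G]] by (auto simp: thompson_lift_iff)
  then have "breakpoints (F \<circ> G) \<subseteq> {x. dyadic x}" by (rule subset_trans[OF breaks])
  ultimately show ?thesis
    using F G degree_one_comp by (simp add: thompson_lift_iff)
qed

lemma thompson_lift_funpow: "thompson_lift F \<Longrightarrow> thompson_lift (F ^^ n)"
  by (induction n) (auto intro: thompson_lift_id thompson_lift_comp simp flip: id_def)

subsection \<open>Dyadic subdivisions\<close>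

definition has_slope_on :: "(real \<Rightarrow> real) \<Rightarrow> real \<Rightarrow> real set \<Rightarrow> bool" where
  "has_slope_on F c A \<longleftrightarrow> (\<forall>x\<in>A. \<forall>y\<in>A. F y - F x = c * (y - x))"

lemma eventually_deriv_if_eventually_affine:
  fixes f :: "'a::real_normed_field \<Rightarrow> 'a"
  assumes "\<forall>\<^sub>F y in nhds x. f y = b + c * (y - x)"
  shows "\<forall>\<^sub>F z in nhds x. (f has_field_derivative c) (at z)"
proof -
  have "\<forall>\<^sub>F z in nhds x. \<forall>\<^sub>F y in nhds z. f y = b + c * (y - x)"
    using assms by (simp add: eventually_eventually)
  then show ?thesis
  proof eventually_elim
    case (elim z)
    have "((\<lambda>y. b + c * (y - x)) has_field_derivative c) (at z)"
      by (auto intro!: derivative_eq_intros)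
    then show ?case using DERIV_cong_ev[OF refl elim refl] by simp
  qed
qed

lemma locally_constant_derivative:
  fixes f :: "real \<Rightarrow> real"
  assumes local: "\<And>x. a < x \<Longrightarrow> x < b \<Longrightarrow>
      \<exists>c\<in>S. \<forall>\<^sub>F z in nhds x. (f has_real_derivative c) (at z)"
    and "a < b"
  obtains c where "c \<in> S" "\<And>x. a < x \<Longrightarrow> x < b \<Longrightarrow> (f has_real_derivative c) (at x)"
proof -
  have deriv: "\<exists>c\<in>S. (f has_real_derivative c) (at x) \<and> (\<forall>\<^sub>F z in nhds x. deriv f z = c)"
    if "a < x" "x < b" for x
  proof -
    obtain c where "c \<in> S" and c: "\<forall>\<^sub>F z in nhds x. (f has_real_derivative c) (at z)"
      using local \<open>a < x\<close> \<open>x < b\<close> by blast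
    from c have "\<forall>\<^sub>F z in nhds x. deriv f z = c" by eventually_elim (rule DERIV_imp_deriv)
    moreover from c have "(f has_real_derivative c) (at x)" by (rule eventually_nhds_x_imp_x)
    ultimately show ?thesis using \<open>c \<in> S\<close> by blast
  qed
  define m where "m = (a + b) / 2"
  have m: "a < m" "m < b" using \<open>a < b\<close> by (simp_all add: m_def)
  have deriv_eq: "deriv f x = deriv f m" if "a < x" "x < b" for x
  proof (rule connected_local_const[of "{a<..<b}" x m "deriv f"])
    show "\<forall>u\<in>{a<..<b}. \<forall>\<^sub>F v in at u within {a<..<b}. deriv f u = deriv f v"
    proof
      fix u assume "u \<in> {a<..<b}"
      then obtain c where c: "\<forall>\<^sub>F v in nhds u. deriv f v = c" using deriv[of u] by auto
      then have "deriv f u = c" by (rule eventually_nhds_x_imp_x)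
      with c show "\<forall>\<^sub>F v in at u within {a<..<b}. deriv f u = deriv f v"
        by (auto simp: eventually_at_filter elim: eventually_mono)
    qed
  qed (use that m in auto)
  show ?thesis
  proof
    show "deriv f m \<in> S" using deriv[OF m] DERIV_imp_deriv by blast
    show "(f has_real_derivative deriv f m) (at x)" if "a < x" "x < b" for x
      using deriv[OF that] deriv_eq[OF that] DERIV_imp_deriv by metis
  qed
qed

lemma locally_affine_imp_affine:
  fixes f :: "real \<Rightarrow> real"
  assumes "a < b" and cont: "continuous_on {a..b} f"
    and local: "\<And>x. a < x \<Longrightarrow> x < b \<Longrightarrow> \<exists>c\<in>S. \<forall>\<^sub>F y in nhds x. f y = f x + c * (y - x)"
  shows "\<exists>c\<in>S. has_slope_on f c {a..b}"
proof -
  obtain c where "c \<in> S" and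
    deriv: "\<And>x. a < x \<Longrightarrow> x < b \<Longrightarrow> (f has_real_derivative c) (at x)"
    using locally_constant_derivative[OF _ \<open>a < b\<close>, of S f] local
      eventually_deriv_if_eventually_affine by metis
  have const: "f x - c * x = f a - c * a" if "x \<in> {a..b}" for x
  proof (rule DERIV_isconst2[OF \<open>a < b\<close>])
    show "continuous_on {a..b} (\<lambda>x. f x - c * x)" using cont by (intro continuous_intros)
    show "((\<lambda>x. f x - c * x) has_real_derivative 0) (at x)" if "a < x" "x < b" for x
      using deriv[OF that] by (auto intro!: derivative_eq_intros)
  qed (use that in auto)
  then have "f y - f x = c * (y - x)" if "x \<in> {a..b}" "y \<in> {a..b}" for x y
    using const[OF that(1)] const[OF that(2)] by (simp add: right_diff_distrib)
  then have "has_slope_on f c {a..b}" by (simp add: has_slope_on_def)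
  with \<open>c \<in> S\<close> show ?thesis by blast
qed

definition dyadic_cell :: "nat \<Rightarrow> int \<Rightarrow> real set" where
  "dyadic_cell N i = {of_int i / 2 ^ N..of_int (i + 1) / 2 ^ N}"

definition affine_on_cells :: "nat \<Rightarrow> (real \<Rightarrow> real) \<Rightarrow> bool" where
  "affine_on_cells N F \<longleftrightarrow>
     (\<forall>i. \<exists>k::int. has_slope_on F (2 powr of_int k) (dyadic_cell N i))"

lemma mem_dyadic_cell_iff:
  "x \<in> dyadic_cell N i \<longleftrightarrow> of_int i \<le> x * 2 ^ N \<and> x * 2 ^ N \<le> of_int i + 1"
  by (simp add: dyadic_cell_def field_simps)

lemma thompson_lift_affine_on_cells:
  assumes F: "thompson_lift F"
  obtains N where "affine_on_cells N F"
proof -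
  have "finite (dyadic_exponent ` frac ` breakpoints F)"
    using F by (simp add: thompson_lift_iff)
  then obtain N where N: "dyadic_exponent x \<le> N" if "x \<in> frac ` breakpoints F" for x
    unfolding finite_nat_set_iff_bounded_le by auto
  have grid: "x * 2 ^ N \<in> \<int>" if x: "x \<in> breakpoints F" for x
  proof -
    have "dyadic_exponent x \<le> N" using N[of "frac x"] x by (simp add: dyadic_exponent_frac)
    moreover have "dyadic x" using F x by (auto simp: thompson_lift_iff)
    ultimately show ?thesis by (simp add: dyadic_exponent_le_iff)
  qed
  have "\<exists>c\<in>range (\<lambda>k::int. 2 powr of_int k). has_slope_on F c (dyadic_cell N i)" for i
    unfolding dyadic_cell_def
  proof (rule locally_affine_imp_affine)
    show "continuous_on {of_int i / 2 ^ N..of_int (i + 1) / 2 ^ N} F"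
      by (intro continuous_at_imp_continuous_on ballI degree_one_isCont thompson_lift_degree_one F)
    fix x :: real assume x: "of_int i / 2 ^ N < x" "x < of_int (i + 1) / 2 ^ N"
    have "x * 2 ^ N \<notin> \<int>"
    proof
      assume "x * 2 ^ N \<in> \<int>"
      then obtain j where "x * 2 ^ N = of_int j" by (rule Ints_cases)
      with x have "i < j" "j < i + 1" by (simp_all add: field_simps flip: of_int_less_iff)
      then show False by simp
    qed
    then have "pow2_affine_at F x" using grid by (auto simp: breakpoints_def)
    then show "\<exists>c\<in>range (\<lambda>k::int. 2 powr of_int k). \<forall>\<^sub>F y in nhds x. F y = F x + c * (y - x)"
      by (auto simp: pow2_affine_at_def)
  qed (simp add: divide_strict_right_mono)
  then have "affine_on_cells N F" by (auto simp: affine_on_cells_def)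
  then show ?thesis by (rule that)
qed

lemma affine_on_cells_eqI:
  assumes F: "degree_one F" "affine_on_cells N F" and G: "degree_one G" "affine_on_cells N G"
    and eq: "\<And>i. 0 \<le> i \<Longrightarrow> i < 2 ^ N \<Longrightarrow> F (of_int i / 2 ^ N) = G (of_int i / 2 ^ N)"
  shows "F = G"
proof
  fix x :: real
  have grid: "F (of_int i / 2 ^ N) = G (of_int i / 2 ^ N)" for i
  proof -
    have "real_of_int i = of_int (i div 2 ^ N * 2 ^ N + i mod 2 ^ N)"
      by (simp only: div_mult_mod_eq)
    then have "real_of_int i / 2 ^ N = of_int (i mod 2 ^ N) / 2 ^ N + of_int (i div 2 ^ N)"
      by (simp add: add_divide_distrib)
    then show ?thesis
      using eq[of "i mod 2 ^ N"] by (simp add: degree_one_add_Ints F(1) G(1))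
  qed
  define i where "i = \<lfloor>x * 2 ^ N\<rfloor>"
  have cell: "of_int i / 2 ^ N \<in> dyadic_cell N i" "of_int (i + 1) / 2 ^ N \<in> dyadic_cell N i"
    "x \<in> dyadic_cell N i"
    unfolding mem_dyadic_cell_iff i_def by simp_all
  have interpolation: "H x = H (of_int i / 2 ^ N) +
      (H (of_int (i + 1) / 2 ^ N) - H (of_int i / 2 ^ N)) * 2 ^ N * (x - of_int i / 2 ^ N)"
    if "affine_on_cells N H" for H
  proof -
    obtain k :: int where "has_slope_on H (2 powr of_int k) (dyadic_cell N i)"
      using \<open>affine_on_cells N H\<close> unfolding affine_on_cells_def by blast
    then have slope: "H y - H (of_int i / 2 ^ N) = 2 powr of_int k * (y - of_int i / 2 ^ N)"
      if "y \<in> dyadic_cell N i" for y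
      using that cell(1) unfolding has_slope_on_def by blast
    have "(H (of_int (i + 1) / 2 ^ N) - H (of_int i / 2 ^ N)) * 2 ^ N = 2 powr of_int k"
      unfolding slope[OF cell(2)] by (simp add: add_divide_distrib)
    then show ?thesis using slope[OF cell(3)] by simp
  qed
  show "F x = G x"
    by (simp only: interpolation[OF F(2)] interpolation[OF G(2)] grid)
qed

lemma countable_thompson_T_set: "countable thompson_T_set"
proof -
  have "countable {F. thompson_lift F \<and> affine_on_cells N F}" for N
  proof (rule countable_image_inj_on)
    let ?values = "\<lambda>F :: real \<Rightarrow> real. \<lambda>i\<in>{0..<2 ^ N}. F (real_of_int i / 2 ^ N)"
    have "?values ` {F. thompson_lift F \<and> affine_on_cells N F} \<subseteq> {0..<2 ^ N} \<rightarrow>\<^sub>E {x. dyadic x}"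
      by (auto simp: thompson_lift_dyadic_iff dyadic_divide_power2_iff dyadic_Ints)
    then show "countable (?values ` {F. thompson_lift F \<and> affine_on_cells N F})"
      by (rule countable_subset) (simp add: countable_PiE countable_dyadic)
    show "inj_on ?values {F. thompson_lift F \<and> affine_on_cells N F}"
    proof (rule inj_onI)
      fix F G assume "F \<in> {F. thompson_lift F \<and> affine_on_cells N F}"
        "G \<in> {F. thompson_lift F \<and> affine_on_cells N F}" and "?values F = ?values G"
      moreover from this have "F (of_int i / 2 ^ N) = G (of_int i / 2 ^ N)"
        if "0 \<le> i" "i < 2 ^ N" for i
        using that by (simp add: fun_eq_iff restrict_def) (metis)
      ultimately show "F = G"
        by (intro affine_on_cells_eqI[of F N G]) (simp_all add: thompson_lift_degree_one)
    qed
  qed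
  then have "countable (\<Union>N. {F. thompson_lift F \<and> affine_on_cells N F})" by simp
  moreover have "{F. thompson_lift F} \<subseteq> (\<Union>N. {F. thompson_lift F \<and> affine_on_cells N F})"
    by (auto elim: thompson_lift_affine_on_cells)
  moreover have "thompson_T_set = (\<lambda>F x. frac (F x)) ` {F. thompson_lift F}"
    by (auto simp: thompson_T_set_def)
  ultimately show ?thesis by (metis countable_image countable_subset)
qed

lemma dyadic_exponent_affine:
  assumes "dyadic x" "dyadic y" "g * 2 ^ N \<in> \<int>"
    and large: "N + nat \<bar>k\<bar> + dyadic_exponent y < dyadic_exponent x"
  shows "int (dyadic_exponent (y + 2 powr of_int k * (x - g))) = int (dyadic_exponent x) - k"
proof -
  let ?z = "y + 2 powr of_int k * (x - g)"
  define d where "d = nat (int (dyadic_exponent x) - k)"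
  have d: "int d = int (dyadic_exponent x) - k" using large by (simp add: d_def)
  have iff: "?z * 2 ^ n \<in> \<int> \<longleftrightarrow> dyadic_exponent x \<le> e"
    if "dyadic_exponent y \<le> n" "N \<le> e" "int n + k = int e" for n e
  proof -
    have "2 powr of_int k * 2 ^ n = 2 powr (of_int k + real n)"
      by (simp add: powr_add powr_realpow)
    also have "of_int k + real n = real e" using that(3) by linarith
    finally have "2 powr of_int k * 2 ^ n = (2::real) ^ e" by (simp add: powr_realpow)
    then have "?z * 2 ^ n = y * 2 ^ n + (x * 2 ^ e - g * 2 ^ e)"
      by (simp add: algebra_simps flip: mult.assoc)
    moreover have "y * 2 ^ n \<in> \<int>" using that(1) assms(2) by (simp add: dyadic_exponent_le_iff)
    moreover have "g * 2 ^ e \<in> \<int>" using assms(3) that(2) by (rule Ints_mult_power2_mono)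
    ultimately show ?thesis by (simp add: dyadic_exponent_le_iff[OF assms(1)])
  qed
  have "?z * 2 ^ d \<in> \<int>"
    using iff[of d "dyadic_exponent x"] large d by linarith
  then have "dyadic ?z" unfolding dyadic_iff_Ints by blast
  have "dyadic_exponent ?z \<le> d"
    using \<open>?z * 2 ^ d \<in> \<int>\<close> by (simp only: dyadic_exponent_le_iff[OF \<open>dyadic ?z\<close>])
  moreover have "\<not> ?z * 2 ^ (d - 1) \<in> \<int>"
    using iff[of "d - 1" "dyadic_exponent x - 1"] large d by linarith
  then have "\<not> dyadic_exponent ?z \<le> d - 1"
    by (simp only: dyadic_exponent_le_iff[OF \<open>dyadic ?z\<close>] not_False_eq_True)
  ultimately have "dyadic_exponent ?z = d" by linarith
  then show ?thesis by (simp only: d)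
qed

lemma dyadic_succ_mem_dyadic_cell:
  assumes "dyadic x" "N < dyadic_exponent x" "x \<in> dyadic_cell N i"
  shows "dyadic_succ x \<in> dyadic_cell N i"
proof -
  define d where "d = dyadic_exponent x"
  have split: "(2::real) ^ d = 2 ^ N * 2 ^ (d - N)"
    using assms(2) by (simp add: d_def flip: power_add)
  have "x * 2 ^ N \<notin> \<int>"
    using dyadic_exponent_le_iff[OF assms(1), of N] assms(2) by simp
  then have "x * 2 ^ N \<noteq> of_int (i + 1)" by (metis Ints_of_int)
  then have "x * 2 ^ N < of_int i + 1" using assms(3) by (simp add: mem_dyadic_cell_iff)
  obtain j where j: "x * 2 ^ d = of_int j"
    using dyadic_exponent_le_iff[OF assms(1), of d] by (auto simp: d_def elim: Ints_cases)
  have "real_of_int j = x * 2 ^ N * 2 ^ (d - N)" by (simp add: split flip: j)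
  also have "\<dots> < (of_int i + 1) * 2 ^ (d - N)"
    using \<open>x * 2 ^ N < of_int i + 1\<close> by simp
  finally have "real_of_int j < of_int ((i + 1) * 2 ^ (d - N))" by simp
  then have "j + 1 \<le> (i + 1) * 2 ^ (d - N)" unfolding of_int_less_iff by linarith
  then have "real_of_int (j + 1) \<le> of_int ((i + 1) * 2 ^ (d - N))" unfolding of_int_le_iff .
  then have "dyadic_succ x * 2 ^ d \<le> (of_int i + 1) * 2 ^ (d - N)"
    by (simp add: dyadic_succ_def distrib_right j flip: d_def)
  then have "dyadic_succ x * 2 ^ N \<le> of_int i + 1" by (simp add: split)
  moreover have "x * 2 ^ N \<le> dyadic_succ x * 2 ^ N" by (simp add: dyadic_succ_def)
  ultimately show ?thesis using assms(3) unfolding mem_dyadic_cell_iff by linarith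
qed

lemma has_slope_on_cell_dyadic_succ:
  fixes N i
  defines "g \<equiv> of_int i / 2 ^ N"
  assumes slope: "has_slope_on F (2 powr of_int k) (dyadic_cell N i)"
    and Fg: "dyadic (F g)" and x: "dyadic x" "x \<in> dyadic_cell N i"
    and large: "N + nat \<bar>k\<bar> + dyadic_exponent (F g) < dyadic_exponent x"
  shows "F (dyadic_succ x) = dyadic_succ (F x)"
proof -
  have "g \<in> dyadic_cell N i" by (simp add: g_def mem_dyadic_cell_iff)
  then have "F x - F g = 2 powr of_int k * (x - g)"
    using slope x(2) unfolding has_slope_on_def by blast
  then have "F x = F g + 2 powr of_int k * (x - g)" by simp
  moreover have "g * 2 ^ N \<in> \<int>" by (simp add: g_def)
  ultimately have "int (dyadic_exponent (F x)) = int (dyadic_exponent x) - k"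
    using dyadic_exponent_affine[OF x(1) Fg _ large] by simp
  then have "real_of_int k = real (dyadic_exponent x) - real (dyadic_exponent (F x))" by linarith
  then have pow2: "2 powr of_int k / 2 ^ dyadic_exponent x = 1 / (2::real) ^ dyadic_exponent (F x)"
    by (simp add: powr_diff powr_realpow)
  have "dyadic_succ x \<in> dyadic_cell N i"
    using dyadic_succ_mem_dyadic_cell x large by simp
  then have "F (dyadic_succ x) - F x = 2 powr of_int k * (dyadic_succ x - x)"
    using slope x(2) unfolding has_slope_on_def by blast
  also have "\<dots> = 2 powr of_int k / 2 ^ dyadic_exponent x" by (simp add: dyadic_succ_def)
  finally show ?thesis by (simp add: pow2 dyadic_succ_def)
qed

lemma thompson_lift_dyadic_succ:
  assumes F: "thompson_lift F"
  obtains M where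
    "\<And>x. dyadic x \<Longrightarrow> dyadic_exponent x > M \<Longrightarrow> F (dyadic_succ x) = dyadic_succ (F x)"
proof -
  note deg_F = thompson_lift_degree_one[OF F]
  obtain N where "affine_on_cells N F" using F by (rule thompson_lift_affine_on_cells)
  then obtain k :: "int \<Rightarrow> int" where
    k: "has_slope_on F (2 powr of_int (k i)) (dyadic_cell N i)" for i
    unfolding affine_on_cells_def by metis
  define bound where "bound i = N + nat \<bar>k i\<bar> + dyadic_exponent (F (of_int i / 2 ^ N))" for i
  have "finite (bound ` {0..<2 ^ N})" by simp
  then obtain M where M: "bound i \<le> M" if "i \<in> {0..<2 ^ N}" for i
    unfolding finite_nat_set_iff_bounded_le by blast
  show ?thesis
  proof (rule that[of M])
    fix x assume x: "dyadic x" "dyadic_exponent x > M"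
    define i where "i = \<lfloor>frac x * 2 ^ N\<rfloor>"
    have "i \<in> {0..<2 ^ N}" by (simp add: i_def floor_less_iff frac_lt_1)
    with x(2) have "bound i < dyadic_exponent (frac x)"
      using M[of i] by (simp add: dyadic_exponent_frac)
    moreover have "frac x \<in> dyadic_cell N i" unfolding mem_dyadic_cell_iff i_def by linarith
    moreover have "dyadic (F (of_int i / 2 ^ N))"
      by (simp add: thompson_lift_dyadic_iff[OF F] dyadic_divide_power2_iff dyadic_Ints)
    ultimately have unit: "F (dyadic_succ (frac x)) = dyadic_succ (F (frac x))"
      using x(1) unfolding bound_def
      by (intro has_slope_on_cell_dyadic_succ[OF k[of i]]) (simp_all add: dyadic_frac_iff)
    define m where "m = real_of_int \<lfloor>x\<rfloor>"
    have "m \<in> \<int>" by (simp add: m_def)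
    have "dyadic_succ (y + m) = dyadic_succ y + m" for y
      by (simp add: dyadic_succ_def dyadic_exponent_add_Ints[OF \<open>m \<in> \<int>\<close>])
    moreover have "x = frac x + m" by (simp add: m_def frac_def)
    ultimately show "F (dyadic_succ x) = dyadic_succ (F x)"
      using unit by (metis degree_one_add_Ints[OF deg_F \<open>m \<in> \<int>\<close>])
  qed
qed

section \<open>Asymptotic points and wandering intervals\<close>

definition asymptotic :: "(real \<Rightarrow> real) \<Rightarrow> real \<Rightarrow> real \<Rightarrow> bool" where
  "asymptotic F x y \<longleftrightarrow> (\<lambda>n. (F ^^ n) x - (F ^^ n) y) \<longlonglongrightarrow> 0"

lemma asymptotic_refl: "asymptotic F x x"
  by (simp add: asymptotic_def)

lemma asymptotic_sym: "asymptotic F x y \<Longrightarrow> asymptotic F y x"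
  unfolding asymptotic_def by (drule tendsto_minus) simp

lemma asymptotic_trans: "asymptotic F x y \<Longrightarrow> asymptotic F y z \<Longrightarrow> asymptotic F x z"
  unfolding asymptotic_def by (drule (1) tendsto_add) simp

lemma asymptotic_funpow_iff: "asymptotic F ((F ^^ k) x) ((F ^^ k) y) \<longleftrightarrow> asymptotic F x y"
proof -
  have "(F ^^ n) ((F ^^ k) z) = (F ^^ (n + k)) z" for n z by (simp add: funpow_add)
  then show ?thesis
    unfolding asymptotic_def
    using LIMSEQ_offset[of "\<lambda>n. (F ^^ n) x - (F ^^ n) y" k 0]
      LIMSEQ_ignore_initial_segment[of "\<lambda>n. (F ^^ n) x - (F ^^ n) y" 0 k] by auto
qed

lemma asymptotic_diff_Ints_iff:
  assumes "degree_one F" "m \<in> \<int>"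
  shows "asymptotic F (x - m) (y - m) \<longleftrightarrow> asymptotic F x y"
  using assms by (simp add: asymptotic_def degree_one_diff_Ints[OF degree_one_funpow])

lemma asymptotic_between:
  assumes F: "degree_one F" and xy: "asymptotic F x y" and z: "min x y \<le> z" "z \<le> max x y"
  shows "asymptotic F x z"
proof (unfold asymptotic_def, rule Lim_null_comparison)
  note le_iff = degree_one_le_iff[OF degree_one_funpow[OF F]]
  have "\<bar>(F ^^ n) x - (F ^^ n) z\<bar> \<le> \<bar>(F ^^ n) x - (F ^^ n) y\<bar>" for n
    using z le_iff[of n x y] le_iff[of n y x] le_iff[of n x z] le_iff[of n z x]
      le_iff[of n y z] le_iff[of n z y] by (auto simp: min_def max_def split: if_splits)
  then show "\<forall>\<^sub>F n in sequentially. norm ((F ^^ n) x - (F ^^ n) z) \<le> \<bar>(F ^^ n) x - (F ^^ n) y\<bar>"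
    by simp
  show "(\<lambda>n. \<bar>(F ^^ n) x - (F ^^ n) y\<bar>) \<longlonglongrightarrow> 0"
    using xy by (simp add: asymptotic_def tendsto_rabs_zero_iff)
qed

lemma asymptotic_less:
  assumes F: "degree_one F" and "asymptotic F x y"
  shows "y < x + 1"
proof (rule ccontr)
  assume "\<not> y < x + 1"
  then have "asymptotic F x (x + 1)"
    by (intro asymptotic_between[OF assms]) auto
  moreover have "(F ^^ n) x - (F ^^ n) (x + 1) = - 1" for n
    using degree_one_add_Ints[OF degree_one_funpow[OF F] Ints_1] by simp
  ultimately show False by (simp add: asymptotic_def LIMSEQ_const_iff)
qed

lemma asymptotic_class_invariant:
  assumes F: "degree_one F" and xy: "asymptotic F u x" "asymptotic F u y"
    and return: "(F ^^ k) x - y \<in> \<int>"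
  shows "(\<lambda>z. (F ^^ k) z - ((F ^^ k) x - y)) ` {z. asymptotic F u z} = {z. asymptotic F u z}"
proof -
  define C where "C = {z. asymptotic F u z}"
  define H where "H z = (F ^^ k) z - ((F ^^ k) x - y)" for z
  have H_x: "H x = y" by (simp add: H_def)
  have H_in: "H z \<in> C \<longleftrightarrow> z \<in> C" for z
  proof -
    have "H z \<in> C \<longleftrightarrow> asymptotic F (H x) (H z)"
      using xy(2) asymptotic_trans asymptotic_sym unfolding C_def H_x by blast
    also have "\<dots> \<longleftrightarrow> asymptotic F x z"
      unfolding H_def by (simp only: asymptotic_diff_Ints_iff[OF F return] asymptotic_funpow_iff)
    also have "\<dots> \<longleftrightarrow> z \<in> C"
      using xy(1) asymptotic_trans asymptotic_sym unfolding C_def by blast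
    finally show ?thesis .
  qed
  have "H ` C = C"
  proof (intro equalityI subsetI)
    fix z assume "z \<in> C"
    define w where "w = inv_into UNIV (F ^^ k) (z + ((F ^^ k) x - y))"
    have "z = H w" by (simp add: H_def w_def degree_one_f_inv[OF degree_one_funpow[OF F]])
    moreover from this have "w \<in> C" using \<open>z \<in> C\<close> H_in[of w] by simp
    ultimately show "z \<in> H ` C" by (rule image_eqI)
  qed (auto simp: H_in)
  then show ?thesis unfolding C_def H_def .
qed

lemma asymptotic_class_Sup:
  fixes F :: "real \<Rightarrow> real" and u :: real
  defines "a \<equiv> Sup {z. asymptotic F u z}"
  assumes F: "degree_one F" and xy: "asymptotic F u x" "asymptotic F u y"
    and return: "(F ^^ k) x - y \<in> \<int>"
  shows "(F ^^ k) a - a = (F ^^ k) x - y"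
proof -
  define C where "C = {z. asymptotic F u z}"
  define H where "H z = (F ^^ k) z - ((F ^^ k) x - y)" for z
  note Fk = degree_one_funpow[OF F, of k]
  have "H (Sup C) = Sup (H ` C)"
  proof (rule continuous_at_Sup_mono)
    show "mono H" by (rule monoI) (simp add: H_def degree_one_le_iff[OF Fk])
    have "isCont H (Sup C)"
      unfolding H_def by (intro isCont_diff degree_one_isCont[OF Fk] continuous_const)
    then show "continuous (at_left (Sup C)) H" by (rule continuous_at_imp_continuous_at_within)
    show "C \<noteq> {}" using xy(1) unfolding C_def by blast
    show "bdd_above C"
      by (rule bdd_aboveI[of _ "u + 1"]) (auto simp: C_def dest: asymptotic_less[OF F])
  qed
  also have "H ` C = C"
    unfolding C_def H_def by (rule asymptotic_class_invariant[OF F xy return])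
  finally show ?thesis by (simp add: H_def a_def C_def)
qed

lemma shift_diff_tendsto_0:
  fixes y :: "nat \<Rightarrow> real"
  assumes mono: "\<And>n. y n \<le> y (n + q)" and bounded: "\<And>n. \<bar>y n\<bar> \<le> B"
  shows "(\<lambda>n. y (n + q) - y n) \<longlonglongrightarrow> 0"
proof (intro summable_LIMSEQ_zero summableI_nonneg_bounded)
  show "0 \<le> y (n + q) - y n" for n using mono by simp
  have "(\<Sum>n<N. y (n + q) - y n) = (\<Sum>n<q. y (N + n) - y n)" for N
  proof (induction N)
    case (Suc N)
    have "(\<Sum>n<q. y (Suc N + n) - y n) =
        (\<Sum>n<q. y (N + n) - y n) + (\<Sum>n<q. y (N + Suc n) - y (N + n))"
      by (simp flip: sum.distrib)
    also have "(\<Sum>n<q. y (N + Suc n) - y (N + n)) = y (N + q) - y N"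
      using sum_lessThan_telescope[of "\<lambda>n. y (N + n)" q] by simp
    finally show ?case using Suc by simp
  qed simp
  moreover have "(\<Sum>n<q. y (N + n) - y n) \<le> (\<Sum>n<q. 2 * B)" for N
  proof (rule sum_mono)
    show "y (N + n) - y n \<le> 2 * B" for n
      using bounded[of "N + n"] bounded[of n] by simp
  qed
  ultimately show "(\<Sum>n<N. y (n + q) - y n) \<le> (\<Sum>n<q. 2 * B)" for N by simp
qed

lemma asymptotic_return:
  assumes F: "degree_one F" and p: "p \<in> \<int>" and b: "(F ^^ q) b = b + p"
  shows "asymptotic F x ((F ^^ q) x - p)"
proof -
  note Fn = degree_one_funpow[OF F]
  define b' where "b' = b + of_int \<lfloor>x - b\<rfloor>"
  define y where "y n = (F ^^ n) x - (F ^^ n) b'" for n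
  have "b' \<le> x" "x \<le> b' + 1" unfolding b'_def by linarith+
  then have y_bounded: "\<bar>y n\<bar> \<le> 1" for n
    using degree_one_le_iff[OF Fn, of n b' x] degree_one_le_iff[OF Fn, of n x "b' + 1"]
      degree_one_add_Ints[OF Fn Ints_1, of n b'] by (simp add: y_def)
  have "(F ^^ q) b' = b' + p"
    by (simp add: b'_def degree_one_add_Ints[OF Fn] b)
  then have y_shift: "y (n + q) - y n = (F ^^ n) ((F ^^ q) x - p) - (F ^^ n) x" for n
    by (simp add: y_def funpow_add degree_one_add_Ints[OF Fn p] degree_one_diff_Ints[OF Fn p])
  have step_le: "y n \<le> y (n + q) \<longleftrightarrow> x \<le> (F ^^ q) x - p" for n
    using y_shift[of n] degree_one_le_iff[OF Fn, of n x "(F ^^ q) x - p"] by linarith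
  have "(\<lambda>n. y (n + q) - y n) \<longlonglongrightarrow> 0"
  proof (cases "x \<le> (F ^^ q) x - p")
    case True
    with step_le y_bounded show ?thesis by (intro shift_diff_tendsto_0) blast+
  next
    case False
    then have "- y n \<le> - y (n + q)" for n using step_le[of n] by simp
    then have "(\<lambda>n. - y (n + q) - - y n) \<longlonglongrightarrow> 0"
      using y_bounded by (intro shift_diff_tendsto_0[of "\<lambda>n. - y n" _ 1]) simp_all
    from tendsto_minus[OF this] show ?thesis by simp
  qed
  then have "asymptotic F ((F ^^ q) x - p) x" by (simp add: asymptotic_def y_shift)
  then show ?thesis by (rule asymptotic_sym)
qed

definition has_periodic_point :: "(real \<Rightarrow> real) \<Rightarrow> nat \<Rightarrow> bool" where
  "has_periodic_point F k \<longleftrightarrow> (\<exists>x. (F ^^ k) x - x \<in> \<int>)"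

definition wandering_interval :: "(real \<Rightarrow> real) \<Rightarrow> real \<Rightarrow> real \<Rightarrow> bool" where
  "wandering_interval F u v \<longleftrightarrow> (\<forall>k. \<forall>x\<in>{u<..<v}. \<forall>y\<in>{u<..<v}.
     (F ^^ k) x - y \<in> \<int> \<longrightarrow> (\<forall>z. (F ^^ k) z - z \<in> \<int>))"

lemma wandering_interval_if_aperiodic:
  assumes F: "degree_one F" and aperiodic: "\<forall>k>0. \<not> has_periodic_point F k"
    and uv: "asymptotic F u v"
  shows "wandering_interval F u v"
  unfolding wandering_interval_def
proof (intro allI ballI impI)
  fix k x y z
  assume x: "x \<in> {u<..<v}" and y: "y \<in> {u<..<v}" and return: "(F ^^ k) x - y \<in> \<int>"
  have "asymptotic F u x" "asymptotic F u y"
    using x y by (auto intro!: asymptotic_between[OF F uv])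
  from asymptotic_class_Sup[OF F this return] return have "has_periodic_point F k"
    unfolding has_periodic_point_def by metis
  with aperiodic have "k = 0" by blast
  then show "(F ^^ k) z - z \<in> \<int>" by simp
qed

lemma funpow_return:
  assumes F: "degree_one F" and p: "p \<in> \<int>"
  shows "((\<lambda>z. (F ^^ q) z - p) ^^ t) x = (F ^^ (q * t)) x - of_nat t * p"
proof (induction t)
  case (Suc t)
  have "(F ^^ (q * Suc t)) x = (F ^^ q) ((F ^^ (q * t)) x)" by (simp add: funpow_add)
  then have "(F ^^ q) ((F ^^ (q * t)) x - of_nat t * p) = (F ^^ (q * Suc t)) x - of_nat t * p"
    using p by (simp add: degree_one_diff_Ints[OF degree_one_funpow[OF F]])
  then show ?case using Suc by (simp add: distrib_right)
qed simp

lemma funpow_periodic_point: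
  assumes F: "degree_one F" and p: "p \<in> \<int>" and x: "(F ^^ q) x = x + p"
  shows "(F ^^ k) x = (F ^^ (k mod q)) x + of_nat (k div q) * p"
proof -
  have "((\<lambda>z. (F ^^ q) z - p) ^^ t) x = x" for t
    using x by (induction t) simp_all
  then have "(F ^^ (q * (k div q))) x = x + of_nat (k div q) * p"
    using funpow_return[OF F p, of "k div q" q x] by simp
  then have "(F ^^ (k mod q)) ((F ^^ (q * (k div q))) x) =
      (F ^^ (k mod q)) x + of_nat (k div q) * p"
    using p by (simp add: degree_one_add_Ints[OF degree_one_funpow[OF F]])
  then show ?thesis by (simp flip: comp_apply[of "F ^^ (k mod q)"] funpow_add)
qed

lemma mono_funpow_notin_fundamental_interval:
  fixes G :: "'a::linorder \<Rightarrow> 'a"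
  assumes G: "strict_mono G" and x: "min c (G c) < x" "x < max c (G c)" and "t > 0"
  shows "(G ^^ t) x \<notin> {min c (G c)<..<max c (G c)}"
proof -
  have mono: "strict_mono (G ^^ n)" for n
    using G by (induction n) (auto simp: strict_mono_def)
  obtain n where t: "t = Suc n" using \<open>t > 0\<close> by (cases t) auto
  show ?thesis
  proof (cases "c \<le> G c")
    case True
    then have "G c \<le> (G ^^ t) c"
      using funpow_mono2[of G 1 t c c] strict_mono_mono[OF G] \<open>t > 0\<close> by simp
    also have "\<dots> < (G ^^ t) x" using x True mono by (simp add: strict_mono_less)
    finally show ?thesis using True by auto
  next
    case False
    have "(G ^^ t) x < (G ^^ t) c" using x False mono by (simp add: strict_mono_less)
    also have "(G ^^ n) c \<le> c"
    proof (induction n)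
      case (Suc n)
      then have "G ((G ^^ n) c) \<le> G c" by (simp add: strict_mono_less_eq[OF G])
      then show ?case using False by simp
    qed simp
    then have "(G ^^ t) c \<le> G c" by (simp add: t strict_mono_less_eq[OF G])
    finally show ?thesis using False by auto
  qed
qed

lemma wandering_fundamental_interval:
  assumes F: "degree_one F" and p: "p \<in> \<int>" and "q > 0"
    and minimal: "\<forall>r\<in>{0<..<q}. \<not> has_periodic_point F r"
    and b: "(F ^^ q) b = b + p"
  shows "wandering_interval F (min c ((F ^^ q) c - p)) (max c ((F ^^ q) c - p))"
  unfolding wandering_interval_def
proof (intro allI ballI impI)
  define G where "G z = (F ^^ q) z - p" for z
  fix k x y z
  assume xy: "x \<in> {min c ((F ^^ q) c - p)<..<max c ((F ^^ q) c - p)}"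
    "y \<in> {min c ((F ^^ q) c - p)<..<max c ((F ^^ q) c - p)}" and return: "(F ^^ k) x - y \<in> \<int>"
  define a where "a = Sup {z. asymptotic F c z}"
  have c: "asymptotic F c ((F ^^ q) c - p)" by (rule asymptotic_return[OF F p b])
  have Fq: "(F ^^ q) a - a = p"
    unfolding a_def using asymptotic_class_Sup[OF F asymptotic_refl c, of q] p by simp
  have "asymptotic F c x" "asymptotic F c y"
    using xy by (auto intro!: asymptotic_between[OF F c])
  then have Fk: "(F ^^ k) a - a = (F ^^ k) x - y"
    unfolding a_def using return by (rule asymptotic_class_Sup[OF F])
  have "(F ^^ k) a = (F ^^ (k mod q)) a + of_nat (k div q) * p"
    using Fq by (intro funpow_periodic_point[OF F p]) simp
  with Fk have Fr: "(F ^^ (k mod q)) a - a = (F ^^ k) x - y - of_nat (k div q) * p" by simp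
  also have "\<dots> \<in> \<int>" using return p by simp
  finally have "has_periodic_point F (k mod q)" unfolding has_periodic_point_def by blast
  then have "k mod q = 0" using minimal \<open>q > 0\<close> by fastforce
  then have k: "k = q * (k div q)" and y: "y = (F ^^ k) x - of_nat (k div q) * p"
    using Fr by auto
  then have "y = (G ^^ (k div q)) x" unfolding G_def funpow_return[OF F p] by simp
  moreover have "strict_mono G"
    using degree_one_funpow[OF F, of q] by (simp add: G_def strict_mono_def degree_one_less_iff)
  ultimately have "k div q = 0"
    using mono_funpow_notin_fundamental_interval[of G c x "k div q"] xy by (auto simp: G_def)
  with k have "k = 0" by simp
  then show "(F ^^ k) z - z \<in> \<int>" by simp
qed

lemma funpow_avoids_translates_near_0:
  assumes F: "degree_one F" and minimal: "\<forall>r\<in>{0<..<q}. \<not> has_periodic_point F r"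
  obtains d where "d > 0"
    "\<And>r x y. r \<in> {0<..<q} \<Longrightarrow> \<bar>x\<bar> < d \<Longrightarrow> \<bar>y\<bar> < d \<Longrightarrow> (F ^^ r) x - y \<notin> \<int>"
proof -
  have "\<forall>\<^sub>F (x, y) in nhds 0 \<times>\<^sub>F nhds 0. \<forall>r\<in>{0<..<q}. (F ^^ r) x - y \<notin> \<int>"
    unfolding case_prod_beta
  proof (intro eventually_ball_finite ballI)
    fix r assume "r \<in> {0<..<q}"
    then have "(F ^^ r) 0 - 0 \<notin> \<int>" using minimal unfolding has_periodic_point_def by blast
    moreover have "((\<lambda>z. (F ^^ r) (fst z) - snd z) \<longlongrightarrow> (F ^^ r) 0 - 0) (nhds 0 \<times>\<^sub>F nhds 0)"
      using degree_one_isCont[OF degree_one_funpow[OF F]]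
      by (intro tendsto_diff isCont_tendsto_compose[of _ "F ^^ r"] filterlim_fst filterlim_snd) auto
    ultimately show "\<forall>\<^sub>F z in nhds 0 \<times>\<^sub>F nhds 0. (F ^^ r) (fst z) - snd z \<notin> \<int>"
      using topological_tendstoD[OF _ open_Compl[OF closed_Ints]] by force
  qed simp
  then obtain Q where "\<forall>\<^sub>F x in nhds 0. Q x" and
    Q: "\<And>x y. Q x \<Longrightarrow> Q y \<Longrightarrow> \<forall>r\<in>{0<..<q}. (F ^^ r) x - y \<notin> \<int>"
    unfolding eventually_prod_same by auto
  then obtain d where "d > 0" "\<And>x. \<bar>x\<bar> < d \<Longrightarrow> Q x"
    unfolding eventually_nhds_metric dist_real_def by auto
  with Q show ?thesis using that by blast
qed

lemma wandering_interval_if_torsion: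
  assumes F: "degree_one F" and "q > 0" and torsion: "\<And>x. (F ^^ q) x - x \<in> \<int>"
    and minimal: "\<forall>r\<in>{0<..<q}. \<not> has_periodic_point F r"
  shows "\<exists>d>0. wandering_interval F 0 d"
proof -
  obtain d where "d > 0" and
    d: "\<And>r x y. r \<in> {0<..<q} \<Longrightarrow> \<bar>x\<bar> < d \<Longrightarrow> \<bar>y\<bar> < d \<Longrightarrow> (F ^^ r) x - y \<notin> \<int>"
    using funpow_avoids_translates_near_0[OF F minimal] by blast
  have "wandering_interval F 0 d"
    unfolding wandering_interval_def
  proof (intro allI ballI impI)
    fix k x y z
    assume xy: "x \<in> {0<..<d}" "y \<in> {0<..<d}" and return: "(F ^^ k) x - y \<in> \<int>"
    have mod: "(F ^^ k) w - (F ^^ (k mod q)) w \<in> \<int>" for w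
    proof -
      have "(F ^^ k) w = (F ^^ (k mod q)) w + of_nat (k div q) * ((F ^^ q) w - w)"
        by (rule funpow_periodic_point[OF F torsion]) simp
      then show ?thesis using torsion by simp
    qed
    have "(F ^^ (k mod q)) x - y \<in> \<int>" using Ints_diff[OF return mod[of x]] by simp
    with d[of "k mod q" x y] xy have "k mod q = 0" using \<open>q > 0\<close> by auto
    then show "(F ^^ k) z - z \<in> \<int>" using mod[of z] by simp
  qed
  with \<open>d > 0\<close> show ?thesis by blast
qed

lemma wandering_interval_if_periodic_point:
  assumes F: "degree_one F" and "k > 0" "has_periodic_point F k"
  shows "\<exists>u v. u < v \<and> wandering_interval F u v"
proof -
  obtain q where "q > 0" and "has_periodic_point F q"
    and minimal: "\<forall>r\<in>{0<..<q}. \<not> has_periodic_point F r"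
    using assms exists_least_iff[of "\<lambda>k. k > 0 \<and> has_periodic_point F k"]
    by (metis greaterThanLessThan_iff)
  then obtain b where b: "(F ^^ q) b - b \<in> \<int>" by (auto simp: has_periodic_point_def)
  show ?thesis
  proof (cases "\<forall>x. (F ^^ q) x - x \<in> \<int>")
    case True
    then show ?thesis
      using wandering_interval_if_torsion[OF F \<open>q > 0\<close> _ minimal] by blast
  next
    case False
    define p where "p = (F ^^ q) b - b"
    have "p \<in> \<int>" using b by (simp add: p_def)
    obtain c where c: "(F ^^ q) c - c \<notin> \<int>" using False by blast
    have "c \<noteq> (F ^^ q) c - p"
    proof
      assume "c = (F ^^ q) c - p"
      then have "(F ^^ q) c - c = p" by simp
      with c \<open>p \<in> \<int>\<close> show False by simp
    qed
    then have "min c ((F ^^ q) c - p) < max c ((F ^^ q) c - p)" by auto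
    moreover have "wandering_interval F (min c ((F ^^ q) c - p)) (max c ((F ^^ q) c - p))"
      by (rule wandering_fundamental_interval[OF F \<open>p \<in> \<int>\<close> \<open>q > 0\<close> minimal, of b])
        (simp add: p_def)
    ultimately show ?thesis by blast
  qed
qed

lemma finite_dyadic_grid: "finite {x::real. 0 \<le> x \<and> x \<le> 1 \<and> x * 2 ^ N \<in> \<int>}"
proof (rule finite_subset)
  show "{x::real. 0 \<le> x \<and> x \<le> 1 \<and> x * 2 ^ N \<in> \<int>} \<subseteq> (\<lambda>i. of_int i / 2 ^ N) ` {0..2 ^ N}"
  proof
    fix x :: real assume "x \<in> {x. 0 \<le> x \<and> x \<le> 1 \<and> x * 2 ^ N \<in> \<int>}"
    then obtain i where "0 \<le> x" "x \<le> 1" and i: "x * 2 ^ N = of_int i" by (auto elim: Ints_cases)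
    then have "0 \<le> real_of_int i" "real_of_int i \<le> 2 ^ N" by (simp_all flip: i)
    then have "i \<in> {0..2 ^ N}" by simp
    moreover have "x = of_int i / 2 ^ N" by (simp add: field_simps flip: i)
    ultimately show "x \<in> (\<lambda>i. of_int i / 2 ^ N) ` {0..2 ^ N}" by blast
  qed
qed simp

lemma inj_frac_funpow_if_aperiodic:
  assumes aperiodic: "\<forall>k>0. \<not> has_periodic_point F k"
  shows "inj (\<lambda>n. frac ((F ^^ n) x))"
proof (rule linorder_injI)
  fix n k :: nat assume "n < k"
  then have "(F ^^ k) x = (F ^^ (k - n)) ((F ^^ n) x)"
    by (simp flip: funpow_add comp_apply[of "F ^^ (k - n)"])
  then have "(F ^^ k) x - (F ^^ n) x \<notin> \<int>"
    using aperiodic \<open>n < k\<close> unfolding has_periodic_point_def by simp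
  then show "frac ((F ^^ n) x) \<noteq> frac ((F ^^ k) x)" by (metis frac_eq_frac_iff)
qed

lemma dyadic_exponent_funpow_at_top:
  assumes F: "thompson_lift F" and aperiodic: "\<forall>k>0. \<not> has_periodic_point F k"
    and x: "dyadic x"
  shows "filterlim (\<lambda>n. dyadic_exponent ((F ^^ n) x)) at_top sequentially"
  unfolding filterlim_at_top
proof
  fix N
  have dyadic: "dyadic ((F ^^ n) x)" for n
    by (simp add: thompson_lift_dyadic_iff[OF thompson_lift_funpow[OF F]] x)
  define A where "A = {n. dyadic_exponent ((F ^^ n) x) \<le> N}"
  have "(\<lambda>n. frac ((F ^^ n) x)) ` A \<subseteq> {x. 0 \<le> x \<and> x \<le> 1 \<and> x * 2 ^ N \<in> \<int>}"
    using dyadic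
    by (auto simp: A_def less_imp_le[OF frac_lt_1] dyadic_frac_iff dyadic_exponent_frac
        simp flip: dyadic_exponent_le_iff)
  then have "finite ((\<lambda>n. frac ((F ^^ n) x)) ` A)"
    by (rule finite_subset[OF _ finite_dyadic_grid])
  moreover have "inj_on (\<lambda>n. frac ((F ^^ n) x)) A"
    using inj_frac_funpow_if_aperiodic[OF aperiodic] by (rule inj_on_subset) simp
  ultimately have "finite A" by (rule finite_imageD)
  then have "\<forall>\<^sub>F n in sequentially. \<not> dyadic_exponent ((F ^^ n) x) \<le> N"
    by (simp add: A_def eventually_cofinite flip: cofinite_eq_sequentially)
  then show "\<forall>\<^sub>F n in sequentially. N \<le> dyadic_exponent ((F ^^ n) x)"
    by eventually_elim simp
qed

lemma thompson_lift_asymptotic_pair: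
  assumes F: "thompson_lift F" and "\<forall>k>0. \<not> has_periodic_point F k"
  obtains u v where "u < v" "asymptotic F u v"
proof -
  note exponent = dyadic_exponent_funpow_at_top[OF assms dyadic_Ints[OF Ints_0]]
  have dyadic: "dyadic ((F ^^ n) 0)" for n
    by (simp add: thompson_lift_dyadic_iff[OF thompson_lift_funpow[OF F]] dyadic_Ints)
  obtain M where M: "F (dyadic_succ x) = dyadic_succ (F x)"
    if "dyadic x" "dyadic_exponent x > M" for x
    using thompson_lift_dyadic_succ[OF F] by blast
  obtain n0 where n0: "dyadic_exponent ((F ^^ n) 0) > M" if "n \<ge> n0" for n
    using exponent unfolding filterlim_at_top eventually_sequentially Suc_le_eq[symmetric] by meson
  define u where "u = (F ^^ n0) 0"
  have u: "(F ^^ n) u = (F ^^ (n + n0)) 0" for n by (simp add: u_def funpow_add)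
  have succ: "(F ^^ n) (dyadic_succ u) = dyadic_succ ((F ^^ n) u)" for n
  proof (induction n)
    case (Suc n)
    then show ?case using M[of "(F ^^ n) u"] n0[of "n + n0"] dyadic by (simp add: u)
  qed simp
  have "filterlim (\<lambda>n. dyadic_exponent ((F ^^ n) u)) at_top sequentially"
    unfolding u by (rule filterlim_compose[OF exponent filterlim_add_const_nat_at_top])
  then have "(\<lambda>n. - ((1 / 2) ^ dyadic_exponent ((F ^^ n) u))) \<longlonglongrightarrow> - (0::real)"
    by (intro tendsto_minus tendsto_power_zero) simp_all
  moreover have "(F ^^ n) u - (F ^^ n) (dyadic_succ u) = - ((1 / 2) ^ dyadic_exponent ((F ^^ n) u))"
    for n
    unfolding succ by (simp add: dyadic_succ_def power_one_over)
  ultimately have "asymptotic F u (dyadic_succ u)" by (simp add: asymptotic_def)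
  moreover have "u < dyadic_succ u" by (simp add: dyadic_succ_def)
  ultimately show ?thesis by (rule that[rotated])
qed

lemma thompson_lift_wandering_interval:
  assumes F: "thompson_lift F"
  obtains u v where "u < v" "wandering_interval F u v"
proof (cases "\<exists>k>0. has_periodic_point F k")
  case True
  then show ?thesis
    using that wandering_interval_if_periodic_point[OF thompson_lift_degree_one[OF F]] by blast
next
  case False
  then have aperiodic: "\<forall>k>0. \<not> has_periodic_point F k" by blast
  then obtain u v where "u < v" "asymptotic F u v"
    using thompson_lift_asymptotic_pair[OF F] by blast
  with aperiodic show ?thesis
    using that wandering_interval_if_aperiodic[OF thompson_lift_degree_one[OF F]] by blast
qed

section \<open>Pushing the complement of an interval into another interval\<close>

lemma dyadic_double_iff: "dyadic (2 * x) \<longleftrightarrow> dyadic x"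
  using dyadic_divide_power2_iff[of "2 * x" 1] by simp

text \<open>On \<open>[0, 1]\<close> this is the standard generator \<open>x\<^sub>0\<close> of Thompson's group \<open>F\<close>.\<close>

definition push :: "real \<Rightarrow> real" where
  "push x = x + min (frac x) (min (1 / 4) ((1 - frac x) / 2))"

lemma push_ge: "x \<le> push x"
  by (simp add: push_def less_imp_le[OF frac_lt_1])

lemma push_eq_iff: "push x = x \<longleftrightarrow> x \<in> \<int>"
proof -
  have "push x = x \<longleftrightarrow> frac x = 0"
    using frac_lt_1[of x] frac_ge_0[of x] by (auto simp: push_def min_def simp del: frac_eq_0_iff)
  then show ?thesis by simp
qed

lemma push_gt: "x \<notin> \<int> \<Longrightarrow> x < push x"
  using push_ge[of x] push_eq_iff[of x] by auto

lemma push_cases: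
  "push x = of_int \<lfloor>x\<rfloor> + 2 * frac x \<and> frac x \<le> 1 / 4 \<or>
   push x = of_int \<lfloor>x\<rfloor> + frac x + 1 / 4 \<and> 1 / 4 \<le> frac x \<and> frac x \<le> 1 / 2 \<or>
   push x = of_int \<lfloor>x\<rfloor> + (frac x + 1) / 2 \<and> 1 / 2 \<le> frac x"
proof -
  have "x = of_int \<lfloor>x\<rfloor> + frac x" by (simp add: frac_def)
  then show ?thesis unfolding push_def min_def by (auto simp: field_simps)
qed

lemma push_bilipschitz:
  assumes "x \<le> y"
  shows "(y - x) / 2 \<le> push y - push x" "push y - push x \<le> 2 * (y - x)"
proof -
  define s t i j where "s = frac x" and "t = frac y"
    and "i = real_of_int \<lfloor>x\<rfloor>" and "j = real_of_int \<lfloor>y\<rfloor>"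
  have st: "0 \<le> s" "s < 1" "0 \<le> t" "t < 1" by (simp_all add: s_def t_def frac_lt_1)
  have xy: "x = i + s" "y = j + t" by (simp_all add: s_def t_def i_def j_def frac_def)
  have "\<lfloor>x\<rfloor> = \<lfloor>y\<rfloor> \<or> \<lfloor>x\<rfloor> + 1 \<le> \<lfloor>y\<rfloor>"
    using floor_mono[OF assms] by linarith
  then have "i = j \<or> i + 1 \<le> j" unfolding i_def j_def by (elim disjE) linarith+
  then have "(y - x) / 2 \<le> push y - push x \<and> push y - push x \<le> 2 * (y - x)"
    using assms st push_cases[of x, folded s_def i_def] push_cases[of y, folded t_def j_def]
    unfolding xy by argo
  then show "(y - x) / 2 \<le> push y - push x" "push y - push x \<le> 2 * (y - x)" by auto
qed

lemma degree_one_push: "degree_one push"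
  unfolding degree_one_def
proof (intro conjI allI)
  show "continuous_on UNIV push"
  proof (rule lipschitz_on_continuous_on)
    show "2-lipschitz_on UNIV push"
    proof (rule lipschitz_onI)
      fix x y
      show "dist (push x) (push y) \<le> 2 * dist x y"
        using push_bilipschitz[of x y] push_bilipschitz[of y x]
        by (cases "x \<le> y") (simp_all add: dist_real_def)
    qed simp
  qed
  show "strict_mono push"
  proof (rule strict_monoI)
    fix x y :: real assume "x < y"
    then show "push x < push y" using push_bilipschitz(1)[of x y] by simp
  qed
  show "push (x + 1) = push x + 1" for x
    by (simp add: push_def frac_1_eq)
qed

lemma dyadic_push_iff: "dyadic (push x) \<longleftrightarrow> dyadic x"
proof -
  have "dyadic (1 / 4)" using dyadic_divide_power2_iff[of 1 2] by (simp add: dyadic_Ints)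
  consider (double) "push x = 2 * x + of_int (- \<lfloor>x\<rfloor>)" | (shift) "push x = x + 1 / 4"
    | (halve) "2 * push x = x + of_int (\<lfloor>x\<rfloor> + 1)"
    using push_cases[of x] unfolding frac_def by (auto simp: field_simps)
  then show ?thesis
    by cases (metis dyadic_double_iff dyadic_add_iff dyadic_Ints Ints_of_int \<open>dyadic (1 / 4)\<close>)+
qed

lemma pow2_affine_atI:
  assumes "a < x" "x < b" "\<And>y. a < y \<Longrightarrow> y < b \<Longrightarrow> F y = 2 powr of_int k * y + c"
  shows "pow2_affine_at F x"
proof -
  have "\<forall>\<^sub>F y in nhds x. y \<in> {a<..<b}" using assms(1,2) by (intro eventually_nhds_in_open) auto
  then have "\<forall>\<^sub>F y in nhds x. F y = F x + 2 powr of_int k * (y - x)"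
    by eventually_elim (use assms in \<open>simp add: algebra_simps\<close>)
  then show ?thesis unfolding pow2_affine_at_def by blast
qed

lemma frac_breakpoints_push_subset: "frac ` breakpoints push \<subseteq> {0, 1 / 4, 1 / 2}"
proof (rule image_subsetI, rule ccontr)
  fix x assume "x \<in> breakpoints push" and not_grid: "frac x \<notin> {0, 1 / 4, 1 / 2}"
  define n where "n = real_of_int \<lfloor>x\<rfloor>"
  have frac_eq: "frac y = y - n" if "n < y" "y < n + 1" for y
    using that unfolding n_def frac_unique_iff by simp
  have "frac x = x - n" by (simp add: n_def frac_def)
  with not_grid consider (double) "n < x" "x < n + 1 / 4" | (shift) "n + 1 / 4 < x" "x < n + 1 / 2"
    | (halve) "n + 1 / 2 < x" "x < n + 1"
    using frac_lt_1[of x] frac_ge_0[of x] by fastforce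
  then have "pow2_affine_at push x"
  proof cases
    case double
    then show ?thesis
      by (rule pow2_affine_atI[of _ _ _ _ 1 "- n"]) (auto simp: push_def frac_eq min_def)
  next
    case shift
    then show ?thesis
      by (rule pow2_affine_atI[of _ _ _ _ 0 "1 / 4"]) (auto simp: push_def frac_eq min_def)
  next
    case halve
    then show ?thesis
      by (rule pow2_affine_atI[of _ _ _ _ "-1" "(n + 1) / 2"])
        (auto simp: push_def frac_eq min_def powr_minus field_simps)
  qed
  with \<open>x \<in> breakpoints push\<close> show False by (simp add: breakpoints_def)
qed

lemma thompson_lift_push: "thompson_lift push"
proof -
  have "dyadic 0" "dyadic (1 / 2)" "dyadic (1 / 4)"
    using dyadic_divide_power2_iff[of 1 1] dyadic_divide_power2_iff[of 1 2]
    by (simp_all add: dyadic_Ints)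
  then have "frac ` breakpoints push \<subseteq> {x. dyadic x}"
    using subset_trans[OF frac_breakpoints_push_subset] by simp
  then have "breakpoints push \<subseteq> {x. dyadic x}" by (auto simp: dyadic_frac_iff)
  moreover have "finite (frac ` breakpoints push)"
    using frac_breakpoints_push_subset by (rule finite_subset) simp
  ultimately show ?thesis
    by (simp add: thompson_lift_iff degree_one_push dyadic_push_iff)
qed

lemma funpow_tendsto_fixed_point:
  fixes f :: "real \<Rightarrow> real"
  assumes "mono f" and cont: "\<And>y. isCont f y" and "x \<le> z" "f z = z"
    and increase: "\<And>y. x \<le> y \<Longrightarrow> y < z \<Longrightarrow> y < f y"
  shows "(\<lambda>n. (f ^^ n) x) \<longlonglongrightarrow> z"
proof -
  have f_ge: "y \<le> f y" if "x \<le> y" "y \<le> z" for y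
    using increase[of y] that \<open>f z = z\<close> by (cases "y = z") auto
  have bounds: "x \<le> (f ^^ n) x \<and> (f ^^ n) x \<le> z" for n
  proof (induction n)
    case (Suc n)
    then have "f ((f ^^ n) x) \<le> f z" using \<open>mono f\<close> by (blast dest: monoD)
    then show ?case using Suc f_ge[of "(f ^^ n) x"] \<open>f z = z\<close> by simp
  qed (use \<open>x \<le> z\<close> in simp)
  then have "incseq (\<lambda>n. (f ^^ n) x)" by (intro incseq_SucI) (simp add: f_ge)
  then obtain L where L: "(\<lambda>n. (f ^^ n) x) \<longlonglongrightarrow> L" "\<And>n. (f ^^ n) x \<le> L"
    using incseq_convergent[of "\<lambda>n. (f ^^ n) x" z] bounds by metis
  have "(\<lambda>n. f ((f ^^ n) x)) \<longlonglongrightarrow> f L"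
    using L(1) cont by (rule isCont_tendsto_compose[rotated])
  moreover have "(\<lambda>n. f ((f ^^ n) x)) \<longlonglongrightarrow> L"
    using LIMSEQ_Suc[OF L(1)] by simp
  ultimately have "f L = L" by (rule LIMSEQ_unique)
  moreover have "x \<le> L" using L(2)[of 0] by simp
  moreover have "L \<le> z" using L(1) bounds by (intro LIMSEQ_le_const2) auto
  ultimately have "L = z" using increase[of L] by fastforce
  with L(1) show ?thesis by simp
qed

lemma dyadic_dense:
  assumes "u < v"
  obtains r where "dyadic r" "u < r" "r < v"
proof -
  obtain N where "1 / 2 ^ N < v - u"
    using real_arch_pow_inv[of "v - u" "1 / 2"] assms by (auto simp: power_one_over)
  define r where "r = of_int (\<lfloor>u * 2 ^ N\<rfloor> + 1) / (2::real) ^ N"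
  have "dyadic r" unfolding r_def dyadic_divide_power2_iff by (simp add: dyadic_Ints)
  moreover have "u < r" unfolding r_def by (simp add: pos_less_divide_eq)
  moreover have "r \<le> u + 1 / 2 ^ N" unfolding r_def by (simp add: field_simps)
  then have "r < v" using \<open>1 / 2 ^ N < v - u\<close> by simp
  ultimately show ?thesis by (rule that)
qed

lemma thompson_lift_into_interval:
  assumes "u < v" "dyadic a" "a < b" "b < a + 1"
  obtains F where "thompson_lift F" "F ` {b..<a + 1} \<subseteq> {u<..<v}"
proof -
  obtain r where r: "dyadic r" "u < r" "r < v" using \<open>u < v\<close> by (rule dyadic_dense)
  have "(\<lambda>n. (push ^^ n) (b - a)) \<longlonglongrightarrow> 1"
  proof (rule funpow_tendsto_fixed_point)
    show "mono push" by (rule monoI) (simp add: degree_one_le_iff[OF degree_one_push])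
    show "y < push y" if "b - a \<le> y" "y < 1" for y
      using that assms(3) by (intro push_gt) (auto elim!: Ints_cases)
  qed (use assms(4) in \<open>simp_all add: push_eq_iff degree_one_isCont[OF degree_one_push]\<close>)
  then have "\<forall>\<^sub>F n in sequentially. 1 - (r - u) < (push ^^ n) (b - a)"
    by (rule order_tendstoD(1)) (use r(2) in linarith)
  then obtain n where n: "1 - (r - u) < (push ^^ n) (b - a)"
    by (auto dest: eventually_happens)
  define F where "F = (\<lambda>x. x + (r + - 1)) \<circ> (push ^^ n) \<circ> (\<lambda>x. x + - a)"
  have "dyadic (r + - 1)" by (rule dyadic_add[OF r(1) dyadic_Ints]) simp
  then have "thompson_lift F"
    unfolding F_def using assms(2)
    by (intro thompson_lift_comp thompson_lift_translation thompson_lift_funpow thompson_lift_push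
        dyadic_minus)
  moreover have "F x \<in> {u<..<v}" if "x \<in> {b..<a + 1}" for x
  proof -
    note push_n = degree_one_funpow[OF degree_one_push, of n]
    have "(push ^^ n) 1 = 1" by (induction n) (simp_all add: push_eq_iff)
    then have "(push ^^ n) (x - a) < 1"
      using degree_one_less_iff[OF push_n, of "x - a" 1] that by simp
    moreover have "(push ^^ n) (b - a) \<le> (push ^^ n) (x - a)"
      using degree_one_le_iff[OF push_n, of "b - a" "x - a"] that by simp
    ultimately show ?thesis using n r by (simp add: F_def)
  qed
  ultimately show ?thesis using that by blast
qed

section \<open>Ping-pong\<close>

context group_action
begin

definition wandering :: "'a set \<Rightarrow> 'c set \<Rightarrow> bool" where
  "wandering H A \<longleftrightarrow> (\<forall>h\<in>H. h \<noteq> \<one> \<longrightarrow> \<phi> h ` A \<inter> A = {})"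

interpretation G: group G
  using group_hom by (rule group_hom.axioms(1))

lemma action_one: "x \<in> E \<Longrightarrow> \<phi> \<one> x = x"
  by (simp flip: id_eq_one)

lemma wandering_generateI:
  assumes s: "s \<in> carrier G" and "A \<subseteq> E"
    and nat_pow: "\<And>(n::nat) x. x \<in> A \<Longrightarrow> \<phi> (s [^] n) x \<in> A \<Longrightarrow> s [^] n = \<one>"
  shows "wandering (generate G {s}) A"
  unfolding wandering_def
proof (intro ballI impI, rule ccontr)
  fix h assume h: "h \<in> generate G {s}" "h \<noteq> \<one>" "\<phi> h ` A \<inter> A \<noteq> {}"
  then obtain k :: int where k: "h = s [^] k" unfolding G.generate_pow[OF s] by blast
  obtain x where x: "x \<in> A" "\<phi> h x \<in> A" using h(3) by blast
  show False
  proof (cases k)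
    case (nonneg n)
    then show False using nat_pow[of x n] x h(2) k by (simp add: int_pow_int)
  next
    case (neg n)
    have inv_h: "inv h = s [^] Suc n"
      unfolding k neg G.int_pow_neg_int[OF s] using s by (intro G.inv_inv) (rule G.nat_pow_closed)
    have "h \<in> carrier G" unfolding k using s by (rule G.int_pow_closed)
    then have "\<phi> (inv h) (\<phi> h x) = x" using orbit_sym_aux x(1) \<open>A \<subseteq> E\<close> by blast
    then have "inv h = \<one>" using nat_pow[of "\<phi> h x" "Suc n"] x by (simp only: inv_h)
    then show False using h(2) \<open>h \<in> carrier G\<close> by (simp add: G.inv_eq_1_iff)
  qed
qed

lemma wandering_conj:
  assumes g: "g \<in> carrier G" and H: "H \<subseteq> carrier G" and A: "A \<subseteq> E" "\<phi> g ` A \<subseteq> B"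
    and wandering: "wandering H B"
  shows "wandering ((\<lambda>h. inv g \<otimes> h \<otimes> g) ` H) A"
  unfolding wandering_def
proof (intro ballI impI equals0I)
  fix c y assume "c \<in> (\<lambda>h. inv g \<otimes> h \<otimes> g) ` H" "c \<noteq> \<one>" and y: "y \<in> \<phi> c ` A \<inter> A"
  then obtain h where "h \<in> H" and c: "c = inv g \<otimes> h \<otimes> g" by blast
  have h: "h \<in> carrier G" using H \<open>h \<in> H\<close> by blast
  have "h \<noteq> \<one>" using \<open>c \<noteq> \<one>\<close> g by (auto simp: c)
  with wandering \<open>h \<in> H\<close> have disjoint: "\<phi> h ` B \<inter> B = {}" unfolding wandering_def by blast
  obtain x where x: "x \<in> A" "y = \<phi> c x" using y by blast
  have "g \<otimes> c = h \<otimes> g" using g h by (simp add: c flip: G.m_assoc)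
  moreover have "c \<in> carrier G" using g h by (simp add: c)
  ultimately have "\<phi> g y = \<phi> h (\<phi> g x)"
    using x A(1) g h by (metis composition_rule subsetD)
  moreover have "\<phi> g x \<in> B" "\<phi> g y \<in> B" using A(2) x(1) y by blast+
  ultimately show False using disjoint by blast
qed

end

lemma (in group) generate_conj:
  assumes g: "g \<in> carrier G" and "K \<subseteq> carrier G"
  shows "generate G ((\<lambda>h. inv g \<otimes> h \<otimes> g) ` K) = (\<lambda>h. inv g \<otimes> h \<otimes> g) ` generate G K"
proof -
  interpret conj: group_hom G G "\<lambda>h. inv g \<otimes> h \<otimes> g"
  proof (unfold_locales, rule homI)
    fix x y assume "x \<in> carrier G" "y \<in> carrier G"
    then show "inv g \<otimes> (x \<otimes> y) \<otimes> g = inv g \<otimes> x \<otimes> g \<otimes> (inv g \<otimes> y \<otimes> g)"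
      using g by (simp add: m_assoc) (simp flip: m_assoc)
  qed (simp add: g)
  show ?thesis using conj.generate_img[OF assms(2)] by simp
qed

locale ping_pong = group_action G E \<phi> for G (structure) and E and \<phi> +
  fixes S :: "'s set" and H and J and p
  assumes subgroup: "s \<in> S \<Longrightarrow> subgroup (H s) G"
    and wandering_complement: "s \<in> S \<Longrightarrow> wandering (H s) (E - J s)"
    and disjoint: "disjoint_family_on J S"
    and base_point: "p \<in> E" "p \<notin> (\<Union>s\<in>S. J s)"
begin

lemma mem_carrier: "s \<in> S \<Longrightarrow> h \<in> H s \<Longrightarrow> h \<in> carrier G"
  by (rule subgroup.mem_carrier[OF subgroup])

lemma action_into:
  assumes "x \<in> E" "s \<in> S" "x \<notin> J s" "h \<in> H s" "h \<noteq> \<one>"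
  shows "\<phi> h x \<in> J s"
proof -
  have "\<phi> h ` (E - J s) \<inter> (E - J s) = {}"
    using wandering_complement assms(2,4,5) unfolding wandering_def by blast
  moreover have "\<phi> h x \<in> E" using element_image mem_carrier assms by blast
  ultimately show ?thesis using assms(1,3) by blast
qed

text \<open>The orbit of \<open>p\<close> under reduced words: the points of \<open>J s\<close> are reached by a syllable from
  \<open>H s\<close>, so the next syllable has to come from another subgroup.\<close>

inductive_set syllable_orbit :: "'c set" where
  base: "p \<in> syllable_orbit"
| step: "x \<in> syllable_orbit \<Longrightarrow> s \<in> S \<Longrightarrow> x \<notin> J s \<Longrightarrow> h \<in> H s \<Longrightarrow> \<phi> h x \<in> syllable_orbit"

lemma syllable_orbit_mem: "x \<in> syllable_orbit \<Longrightarrow> x \<in> E"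
  by (induction rule: syllable_orbit.induct) (auto intro: base_point element_image mem_carrier)

lemma syllable_orbit_covered: "x \<in> syllable_orbit \<Longrightarrow> x \<in> insert p (\<Union>s\<in>S. J s)"
proof (induction rule: syllable_orbit.induct)
  case (step x s h)
  note x = syllable_orbit_mem[OF step.hyps(1)]
  show ?case
  proof (cases "h = \<one>")
    case True
    with step.IH show ?thesis by (simp add: action_one[OF x])
  next
    case False
    then have "\<phi> h x \<in> J s" by (rule action_into[OF x step.hyps(2-4)])
    with step.hyps(2) show ?thesis by blast
  qed
qed simp

lemma syllable_orbit_closed:
  assumes "x \<in> syllable_orbit" and s: "s \<in> S" "h \<in> H s"
  shows "\<phi> h x \<in> syllable_orbit"
  using assms(1) s(2)
proof (induction arbitrary: h rule: syllable_orbit.induct)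
  case base
  then show ?case using base_point s(1) by (intro syllable_orbit.intros) auto
next
  case (step x t k)
  note x = syllable_orbit_mem[OF step.hyps(1)]
  consider (trivial) "k = \<one>" | (same) "s = t" | (different) "k \<noteq> \<one>" "s \<noteq> t" by blast
  then show ?case
  proof cases
    case trivial
    then show ?thesis using step action_one[OF x] by simp
  next
    case same
    then have "\<phi> h (\<phi> k x) = \<phi> (h \<otimes> k) x"
      using step s by (simp add: composition_rule x mem_carrier)
    moreover have "h \<otimes> k \<in> H t"
      using same step s by (simp add: subgroup.m_closed[OF subgroup])
    ultimately show ?thesis using step by (simp add: syllable_orbit.step)
  next
    case different
    then have "\<phi> k x \<notin> J s"
      using action_into[OF x] step.hyps disjoint_family_onD[OF disjoint s(1) step.hyps(2)] by blast
    then show ?thesis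
      using syllable_orbit.step[OF syllable_orbit.step[OF step.hyps] s(1) _ step.prems] by blast
  qed
qed

theorem orbit_covered:
  assumes "g \<in> generate G (\<Union>s\<in>S. H s)"
  shows "\<phi> g p \<in> insert p (\<Union>s\<in>S. J s)"
proof -
  interpret G: group G
    using group_hom by (rule group_hom.axioms(1))
  have "(\<Union>s\<in>S. H s) \<subseteq> carrier G" using mem_carrier by blast
  note generate_carrier = G.generate_in_carrier[OF this]
  from assms have "\<forall>x\<in>syllable_orbit. \<phi> g x \<in> syllable_orbit"
  proof induction
    case one
    then show ?case using action_one syllable_orbit_mem by simp
  next
    case (incl h)
    then show ?case using syllable_orbit_closed by blast
  next
    case (inv h)
    then show ?case using syllable_orbit_closed subgroup.m_inv_closed[OF subgroup] by blast
  next
    case (eng h k)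
    then show ?case using syllable_orbit_mem generate_carrier by (simp add: composition_rule)
  qed
  then show ?thesis using syllable_orbit.base syllable_orbit_covered by blast
qed

end

theorem (in group_action) not_invariably_generated:
  fixes J :: "nat \<Rightarrow> 'c set"
  assumes "countable (carrier G)" and disjoint: "disjoint_family J"
    and conj: "\<And>s n. s \<in> carrier G \<Longrightarrow>
      \<exists>g\<in>carrier G. wandering (generate G {inv g \<otimes> s \<otimes> g}) (E - J n)"
    and p: "p \<in> E" "p \<notin> (\<Union>n. J n)" and q: "q \<in> orbit G \<phi> p" "q \<notin> insert p (\<Union>n. J n)"
  shows "\<not> invariably_generated G"
proof
  interpret G: group G
    using group_hom by (rule group_hom.axioms(1))
  assume "invariably_generated G"
  then obtain S where S: "S \<subseteq> carrier G" and
    gen: "\<And>g. g \<in> S \<rightarrow> carrier G \<Longrightarrow> generate G ((\<lambda>s. inv (g s) \<otimes> s \<otimes> g s) ` S) = carrier G"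
    unfolding invariably_generated_def by blast
  define index where "index = to_nat_on (carrier G)"
  have "inj_on index S"
    using inj_on_to_nat_on[OF assms(1)] S unfolding index_def by (rule inj_on_subset)
  then have disjoint_S: "disjoint_family_on (\<lambda>s. J (index s)) S"
    using disjoint unfolding disjoint_family_on_def inj_on_def by blast
  have "\<forall>s\<in>S. \<exists>g. g \<in> carrier G \<and> wandering (generate G {inv g \<otimes> s \<otimes> g}) (E - J (index s))"
    using conj S by blast
  then obtain g where g: "\<And>s. s \<in> S \<Longrightarrow> g s \<in> carrier G" and
    wandering: "\<And>s. s \<in> S \<Longrightarrow> wandering (generate G {inv (g s) \<otimes> s \<otimes> g s}) (E - J (index s))"
    by metis
  define c where "c s = inv (g s) \<otimes> s \<otimes> g s" for s
  have c: "c s \<in> carrier G" if "s \<in> S" for s using g[OF that] S that by (auto simp: c_def)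
  obtain r where "r \<in> carrier G" "q = \<phi> r p" using q(1) by (auto simp: orbit_def)
  then have "r \<in> generate G (c ` S)" using gen[of g] g by (simp add: c_def)
  also have "\<dots> \<subseteq> generate G (\<Union>s\<in>S. generate G {c s})"
    by (intro G.mono_generate) (auto intro: generate.incl)
  finally have r: "r \<in> generate G (\<Union>s\<in>S. generate G {c s})" .
  interpret ping_pong G E \<phi> S "\<lambda>s. generate G {c s}" "\<lambda>s. J (index s)" p
  proof (intro ping_pong.intro group_action_axioms ping_pong_axioms.intro)
    fix s assume s: "s \<in> S"
    show "subgroup (generate G {c s}) G"
      using c[OF s] by (intro G.generate_is_subgroup) simp
    show "wandering (generate G {c s}) (E - J (index s))"
      using wandering[OF s] by (simp add: c_def)
  qed (use p disjoint_S in auto)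
  show False using orbit_covered[OF r] q(2) \<open>q = \<phi> r p\<close> by blast
qed

section \<open>Thompson's group \<open>T\<close>\<close>

definition circle_map :: "(real \<Rightarrow> real) \<Rightarrow> real \<Rightarrow> real" where
  "circle_map F = (\<lambda>x. frac (F x))"

lemma carrier_thompson_T: "carrier thompson_T = circle_map ` {F. thompson_lift F}"
  and mult_thompson_T: "f \<otimes>\<^bsub>thompson_T\<^esub> g = f \<circ> g"
  and one_thompson_T: "\<one>\<^bsub>thompson_T\<^esub> = circle_map id"
  by (auto simp: thompson_T_def thompson_T_set_def circle_map_def)

lemma circle_map_mult:
  "degree_one F \<Longrightarrow> circle_map F \<otimes>\<^bsub>thompson_T\<^esub> circle_map G = circle_map (F \<circ> G)"
  by (auto simp: mult_thompson_T circle_map_def frac_degree_one_frac)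

lemma group_thompson_T: "group thompson_T"
proof (rule groupI)
  fix f g assume "f \<in> carrier thompson_T" "g \<in> carrier thompson_T"
  then show "f \<otimes>\<^bsub>thompson_T\<^esub> g \<in> carrier thompson_T"
    by (auto simp: carrier_thompson_T circle_map_mult thompson_lift_degree_one
        intro: thompson_lift_comp)
next
  show "\<one>\<^bsub>thompson_T\<^esub> \<in> carrier thompson_T"
    by (simp add: carrier_thompson_T one_thompson_T thompson_lift_id)
next
  fix f assume "f \<in> carrier thompson_T"
  then obtain F where F: "thompson_lift F" "f = circle_map F" by (auto simp: carrier_thompson_T)
  note deg_F = thompson_lift_degree_one[OF F(1)]
  show "\<one>\<^bsub>thompson_T\<^esub> \<otimes>\<^bsub>thompson_T\<^esub> f = f"
    by (simp add: F(2) one_thompson_T circle_map_mult[OF degree_one_id])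
  have "circle_map (inv_into UNIV F) \<otimes>\<^bsub>thompson_T\<^esub> f = \<one>\<^bsub>thompson_T\<^esub>"
    using bij_is_inj[OF degree_one_bij[OF deg_F]]
    by (simp add: F(2) circle_map_mult[OF degree_one_inv[OF deg_F]] one_thompson_T)
  then show "\<exists>g\<in>carrier thompson_T. g \<otimes>\<^bsub>thompson_T\<^esub> f = \<one>\<^bsub>thompson_T\<^esub>"
    using thompson_lift_inv[OF F(1)] by (auto simp: carrier_thompson_T)
qed (simp add: mult_thompson_T comp_assoc)

interpretation T: group thompson_T
  by (rule group_thompson_T)

lemma circle_map_nat_pow:
  "degree_one F \<Longrightarrow> circle_map F [^]\<^bsub>thompson_T\<^esub> (n::nat) = circle_map (F ^^ n)"
proof (induction n)
  case 0
  show ?case by (simp add: one_thompson_T id_def)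
next
  case (Suc n)
  then have "circle_map F [^]\<^bsub>thompson_T\<^esub> Suc n = circle_map (F ^^ n) \<otimes>\<^bsub>thompson_T\<^esub> circle_map F"
    by simp
  also have "\<dots> = circle_map (F ^^ n \<circ> F)"
    by (rule circle_map_mult[OF degree_one_funpow[OF Suc.prems]])
  also have "F ^^ n \<circ> F = F ^^ Suc n" by (rule funpow_Suc_right[symmetric])
  finally show ?case .
qed

lemma group_action_thompson_T:
  "group_action thompson_T {0..<1} (\<lambda>f. restrict f {0..<1})"
proof -
  have maps: "f x \<in> {0..<1}" if "f \<in> carrier thompson_T" for f x
    using that by (auto simp: carrier_thompson_T circle_map_def frac_lt_1)
  have cancel: "f (g x) = x"
    if "f \<otimes>\<^bsub>thompson_T\<^esub> g = \<one>\<^bsub>thompson_T\<^esub>" "x \<in> {0..<1}" for f g x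
    using fun_cong[OF that(1), of x] that(2)
    by (simp add: mult_thompson_T one_thompson_T circle_map_def frac_eq)
  have Bij: "restrict f {0..<1} \<in> Bij {0..<1}" if f: "f \<in> carrier thompson_T" for f
  proof -
    have "bij_betw f {0..<1} {0..<1}"
      using maps[OF f] maps[OF T.inv_closed[OF f]] cancel[OF T.r_inv[OF f]] cancel[OF T.l_inv[OF f]]
      by (intro bij_betw_byWitness[of _ "inv\<^bsub>thompson_T\<^esub> f"]) blast+
    then show ?thesis by (simp add: Bij_def)
  qed
  have "(\<lambda>f. restrict f {0..<1}) \<in> hom thompson_T (BijGroup {0..<1})"
  proof (rule homI)
    fix f g assume fg: "f \<in> carrier thompson_T" "g \<in> carrier thompson_T"
    have "restrict (f \<circ> g) {0..<1} = compose {0..<1} (restrict f {0..<1}) (restrict g {0..<1})"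
      using maps[OF fg(2)] by (auto simp: compose_def restrict_def)
    then show "restrict (f \<otimes>\<^bsub>thompson_T\<^esub> g) {0..<1} =
        restrict f {0..<1} \<otimes>\<^bsub>BijGroup {0..<1}\<^esub> restrict g {0..<1}"
      by (simp add: mult_thompson_T BijGroup_def Bij fg)
  qed (simp add: BijGroup_def Bij)
  then show ?thesis
    by (intro group_action.intro group_hom.intro group_hom_axioms.intro
        group_thompson_T group_BijGroup)
qed

interpretation circle: group_action thompson_T "{0..<1}" "\<lambda>f. restrict f {0..<1}"
  by (rule group_action_thompson_T)

lemma thompson_T_wandering:
  assumes "s \<in> carrier thompson_T"
  obtains u v where "u < v" "circle.wandering (generate thompson_T {s}) (frac ` {u<..<v})"
proof -
  obtain F where F: "thompson_lift F" and s: "s = circle_map F"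
    using assms by (auto simp: carrier_thompson_T)
  note deg_F = thompson_lift_degree_one[OF F]
  obtain u v where "u < v" and wandering: "wandering_interval F u v"
    using F by (rule thompson_lift_wandering_interval)
  have "circle.wandering (generate thompson_T {s}) (frac ` {u<..<v})"
  proof (rule circle.wandering_generateI[OF assms])
    show "frac ` {u<..<v} \<subseteq> {0..<1}" by (auto simp: frac_lt_1)
    fix n :: nat and x
    assume "x \<in> frac ` {u<..<v}" "restrict (s [^]\<^bsub>thompson_T\<^esub> n) {0..<1} x \<in> frac ` {u<..<v}"
    then obtain a b where ab: "a \<in> {u<..<v}" "b \<in> {u<..<v}" and "x = frac a"
      and "circle_map (F ^^ n) x = frac b"
      by (auto simp: s circle_map_nat_pow[OF deg_F] frac_lt_1)
    then have "frac ((F ^^ n) a) = frac b"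
      by (simp add: circle_map_def frac_degree_one_frac[OF degree_one_funpow[OF deg_F]])
    then have "\<forall>z. (F ^^ n) z - z \<in> \<int>"
      using wandering ab unfolding wandering_interval_def frac_eq_frac_iff by blast
    then show "s [^]\<^bsub>thompson_T\<^esub> n = \<one>\<^bsub>thompson_T\<^esub>"
      unfolding s circle_map_nat_pow[OF deg_F] one_thompson_T
      by (simp add: circle_map_def fun_eq_iff frac_eq_frac_iff)
  qed
  with \<open>u < v\<close> show ?thesis by (rule that)
qed

lemma thompson_T_conj_wandering:
  assumes s: "s \<in> carrier thompson_T" and ab: "dyadic a" "0 \<le> a" "a < b" "b < 1"
  shows "\<exists>g\<in>carrier thompson_T. circle.wandering
    (generate thompson_T {inv\<^bsub>thompson_T\<^esub> g \<otimes>\<^bsub>thompson_T\<^esub> s \<otimes>\<^bsub>thompson_T\<^esub> g}) ({0..<1} - {a..<b})"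
proof -
  obtain u v where "u < v" and
    wandering: "circle.wandering (generate thompson_T {s}) (frac ` {u<..<v})"
    using s by (rule thompson_T_wandering)
  obtain F where F: "thompson_lift F" and into: "F ` {b..<a + 1} \<subseteq> {u<..<v}"
    using thompson_lift_into_interval[OF \<open>u < v\<close> ab(1,3)] ab by auto
  have "circle_map F x \<in> frac ` {u<..<v}" if x: "x \<in> {0..<1} - {a..<b}" for x
  proof -
    obtain y where y: "y \<in> {b..<a + 1}" "y - x \<in> \<int>"
    proof (cases "x < a")
      case True
      then show ?thesis using that[of "x + 1"] x ab by auto
    next
      case False
      then show ?thesis using that[of x] x ab by auto
    qed
    then have "F y = F x + (y - x)"
      using degree_one_add_Ints[OF thompson_lift_degree_one[OF F] y(2), of x] by simp
    then have "circle_map F x = frac (F y)"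
      using y(2) by (simp add: circle_map_def frac_add_int_right)
    with into y(1) show ?thesis by blast
  qed
  then have into_uv: "restrict (circle_map F) {0..<1} ` ({0..<1} - {a..<b}) \<subseteq> frac ` {u<..<v}"
    by auto
  have g: "circle_map F \<in> carrier thompson_T" using F by (simp add: carrier_thompson_T)
  have "generate thompson_T {s} \<subseteq> carrier thompson_T" using s by (simp add: T.generate_incl)
  from circle.wandering_conj[OF g this _ into_uv wandering]
  have "circle.wandering (generate thompson_T
      {inv\<^bsub>thompson_T\<^esub> (circle_map F) \<otimes>\<^bsub>thompson_T\<^esub> s \<otimes>\<^bsub>thompson_T\<^esub> circle_map F})
      ({0..<1} - {a..<b})"
    using T.generate_conj[OF g, of "{s}"] s by auto
  with g show ?thesis by blast
qed

lemma dyadic_mem_orbit_thompson_T: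
  assumes "dyadic x" "dyadic y" "x \<in> {0..<1}" "y \<in> {0..<1}"
  shows "y \<in> orbit thompson_T (\<lambda>f. restrict f {0..<1}) x"
proof -
  have "thompson_lift (\<lambda>z. z + (y + - x))"
    using assms(1,2) by (intro thompson_lift_translation dyadic_add dyadic_minus)
  then have rotation: "circle_map (\<lambda>z. z + (y + - x)) \<in> carrier thompson_T"
    by (simp add: carrier_thompson_T)
  have "y = restrict (circle_map (\<lambda>z. z + (y + - x))) {0..<1} x"
    using assms(3,4) by (simp add: circle_map_def frac_eq)
  with rotation show ?thesis unfolding orbit_def by (intro CollectI exI conjI)
qed

definition dyadic_endpoint :: "nat \<Rightarrow> real" where
  "dyadic_endpoint n = 1 / 2 - 1 / 2 ^ Suc n"

lemma dyadic_dyadic_endpoint: "dyadic (dyadic_endpoint n)"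
proof -
  have "dyadic (1 / 2 ^ k)" for k by (simp add: dyadic_divide_power2_iff dyadic_Ints)
  from dyadic_add[OF this[of 1] dyadic_minus[OF this[of "Suc n"]]]
  show ?thesis by (simp add: dyadic_endpoint_def)
qed

lemma dyadic_endpoint_bounds: "0 \<le> dyadic_endpoint n" "dyadic_endpoint n < 1 / 2"
proof -
  have "(1::real) \<le> 2 ^ n" by (rule one_le_power) simp
  then show "0 \<le> dyadic_endpoint n" by (simp add: dyadic_endpoint_def field_simps)
qed (simp add: dyadic_endpoint_def)

lemma dyadic_endpoint_Suc_greater: "dyadic_endpoint n < dyadic_endpoint (Suc n)"
  by (simp add: dyadic_endpoint_def field_simps)

lemma disjoint_family_dyadic_endpoint:
  "disjoint_family (\<lambda>n. {dyadic_endpoint n..<dyadic_endpoint (Suc n)})"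
proof -
  have "{dyadic_endpoint n..<dyadic_endpoint (Suc n)} =
      {..<dyadic_endpoint (Suc n)} - {..<dyadic_endpoint n}" for n
    by auto
  moreover have "disjoint_family (\<lambda>n. {..<dyadic_endpoint (Suc n)} - {..<dyadic_endpoint n})"
    by (intro disjoint_family_Suc) (simp add: less_imp_le dyadic_endpoint_Suc_greater)
  ultimately show ?thesis by simp
qed

theorem theorem4p6:
  shows "\<not> invariably_generated thompson_T"
proof (rule circle.not_invariably_generated)
  let ?J = "\<lambda>n. {dyadic_endpoint n..<dyadic_endpoint (Suc n)}"
  show "countable (carrier thompson_T)"
    using countable_thompson_T_set by (simp add: thompson_T_def)
  show "disjoint_family ?J" by (rule disjoint_family_dyadic_endpoint)
  show "\<exists>g\<in>carrier thompson_T. circle.wandering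
      (generate thompson_T {inv\<^bsub>thompson_T\<^esub> g \<otimes>\<^bsub>thompson_T\<^esub> s \<otimes>\<^bsub>thompson_T\<^esub> g}) ({0..<1} - ?J n)"
    if "s \<in> carrier thompson_T" for s n
    using that dyadic_endpoint_bounds[of n] dyadic_endpoint_bounds[of "Suc n"]
    by (intro thompson_T_conj_wandering dyadic_dyadic_endpoint dyadic_endpoint_Suc_greater) auto
  have "?J n \<subseteq> {..<1 / 2}" for n
    using dyadic_endpoint_bounds(2)[of "Suc n"] by auto
  then show "1 / 2 \<notin> (\<Union>n. ?J n)" "3 / 4 \<notin> insert (1 / 2) (\<Union>n. ?J n)" by fastforce+
  show "3 / 4 \<in> orbit thompson_T (\<lambda>f. restrict f {0..<1}) (1 / 2)"
    using dyadic_divide_power2_iff[of 1 1] dyadic_divide_power2_iff[of 3 2]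
    by (intro dyadic_mem_orbit_thompson_T) (simp_all add: dyadic_Ints)
qed simp

end
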